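(* Let $(a_n)_{n=1}^\infty$ be a sequence of positive numbers such that $\lim_{n\to\infty} a_{n+1}/a_n = 0$, let $J = SA + AS^*$ be the associated Jacobi operator on $\ell_2(\mathbb{N})$, and let $(\lambda_n)_{n=1}^\infty$ be the sequence of positive eigenvalues of $J$ enumerated in decreasing order. Then $$\lambda_n = (1+o(1))\,a_{2n-1}, \qquad n\to\infty,$$ that is, $\lim_{n\to\infty} \lambda_n/a_{2n-1} = 1$.
   Context: $H=\ell_2(\mathbb{N})$ is the complex Hilbert space of square-summable sequences indexed by $\mathbb{N}=\{1,2,\dots\}$, with standard basis $(e_n)_{n=1}^\infty$. $S$ is the right-shift operator, $Se_n = e_{n+1}$, $S^*$ is its adjoint, and $A$ is the diagonal operator $Ae_n = a_n e_n$. Thus $Je_1 = a_1 e_2$ and $Je_n = a_{n-1}e_{n-1} + a_n e_{n+1}$ for $n\ge 2$. Under the stated conditions $J$ is compact and self-adjoint, all of its eigenvalues are simple and nonzero, and its point spectrum is symmetric with respect to zero, so $\sigma_p(J)=\{\pm\lambda_n \mid n\in\mathbb{N}\}$, where $(\lambda_n)_{n=1}^\infty$ is a sequence of positive numbers monotonically tending to zero. *)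

theory Defs
  imports "HOL-Analysis.Analysis" "HOL-Library.FuncSet"
begin

text \<open>
  Sequences are indexed by the positive integers. They are represented as functions on
  \<^typ>\<open>nat\<close>: vectors vanish at the dummy index 0, and the value of a coefficient
  sequence \<open>a\<close> at 0 is irrelevant. An operator on \<open>ell2\<close> is represented by a function on all
  sequences, of which only the values on \<open>ell2\<close> matter.
\<close>

definition ell2 :: "(nat \<Rightarrow> complex) set" where
  "ell2 = {x. x 0 = 0 \<and> summable (\<lambda>n. (cmod (x n))\<^sup>2)}"

definition ell2_inner :: "(nat \<Rightarrow> complex) \<Rightarrow> (nat \<Rightarrow> complex) \<Rightarrow> complex" where
  "ell2_inner x y = (\<Sum>n. x n * cnj (y n))"

definition basis_vec :: "nat \<Rightarrow> nat \<Rightarrow> complex" where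
  "basis_vec k = (\<lambda>n. if n = k then 1 else 0)"

definition shift_op :: "(nat \<Rightarrow> complex) \<Rightarrow> nat \<Rightarrow> complex" where
  "shift_op x = (\<lambda>n. if n = 0 then 0 else x (n - 1))"

definition diag_op :: "(nat \<Rightarrow> real) \<Rightarrow> (nat \<Rightarrow> complex) \<Rightarrow> nat \<Rightarrow> complex" where
  "diag_op a x = (\<lambda>n. complex_of_real (a n) * x n)"

text \<open>Extensionality (the value is \<^const>\<open>undefined\<close> outside \<open>ell2\<close>) makes the
  adjoint unique as a HOL function.\<close>

definition adjoint_op ::
    "((nat \<Rightarrow> complex) \<Rightarrow> nat \<Rightarrow> complex) \<Rightarrow> (nat \<Rightarrow> complex) \<Rightarrow> nat \<Rightarrow> complex" where
  "adjoint_op T = (THE T'. T' \<in> ell2 \<rightarrow>\<^sub>E ell2 \<and>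
     (\<forall>x\<in>ell2. \<forall>y\<in>ell2. ell2_inner (T x) y = ell2_inner x (T' y)))"

definition jacobi_op :: "(nat \<Rightarrow> real) \<Rightarrow> (nat \<Rightarrow> complex) \<Rightarrow> nat \<Rightarrow> complex" where
  "jacobi_op a x =
     (\<lambda>n. shift_op (diag_op a x) n + diag_op a (adjoint_op shift_op x) n)"

definition point_spectrum :: "((nat \<Rightarrow> complex) \<Rightarrow> nat \<Rightarrow> complex) \<Rightarrow> complex set" where
  "point_spectrum T = {\<mu>. \<exists>x\<in>ell2. x \<noteq> (\<lambda>n. 0) \<and> T x = (\<lambda>n. \<mu> * x n)}"

definition positive_eigenvalues :: "((nat \<Rightarrow> complex) \<Rightarrow> nat \<Rightarrow> complex) \<Rightarrow> real set" where
  "positive_eigenvalues T = {\<mu>. 0 < \<mu> \<and> complex_of_real \<mu> \<in> point_spectrum T}"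

lemma basis_vec_in_ell2: "k \<ge> 1 \<Longrightarrow> basis_vec k \<in> ell2"
proof -
  have "summable (\<lambda>n. (cmod (basis_vec k n))\<^sup>2)"
    by (rule summable_finite[of "{k}"]) (auto simp: basis_vec_def)
  then show "k \<ge> 1 \<Longrightarrow> basis_vec k \<in> ell2"
    by (auto simp: ell2_def basis_vec_def)
qed

lemma ell2_add:
  assumes "x \<in> ell2" "y \<in> ell2"
  shows "(\<lambda>n. x n + y n) \<in> ell2"
proof -
  have s: "summable (\<lambda>n. 2 * (cmod (x n))\<^sup>2 + 2 * (cmod (y n))\<^sup>2)"
    using assms by (intro summable_add summable_mult) (auto simp: ell2_def)
  have "(cmod (x n + y n))\<^sup>2 \<le> 2 * (cmod (x n))\<^sup>2 + 2 * (cmod (y n))\<^sup>2" for n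
  proof -
    have "(cmod (x n + y n))\<^sup>2 \<le> (cmod (x n) + cmod (y n))\<^sup>2"
      by (intro power_mono norm_triangle_ineq) auto
    also have "\<dots> \<le> 2 * (cmod (x n))\<^sup>2 + 2 * (cmod (y n))\<^sup>2"
      using sum_squares_bound[of "cmod (x n)" "cmod (y n)"] by (simp add: power2_sum)
    finally show ?thesis .
  qed
  then have "summable (\<lambda>n. (cmod (x n + y n))\<^sup>2)"
    by (intro summable_comparison_test[OF _ s]) auto
  with assms show ?thesis by (auto simp: ell2_def)
qed

lemma ell2_inner_summable:
  assumes "x \<in> ell2" "y \<in> ell2"
  shows "summable (\<lambda>n. x n * cnj (y n))"
proof -
  have s: "summable (\<lambda>n. (cmod (x n))\<^sup>2 + (cmod (y n))\<^sup>2)"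
    using assms by (intro summable_add) (auto simp: ell2_def)
  have "norm (x n * cnj (y n)) \<le> (cmod (x n))\<^sup>2 + (cmod (y n))\<^sup>2" for n
  proof -
    have "0 \<le> cmod (x n) * cmod (y n)" by simp
    then show ?thesis
      using sum_squares_bound[of "cmod (x n)" "cmod (y n)"]
      unfolding norm_mult complex_mod_cnj by linarith
  qed
  then show ?thesis by (intro summable_comparison_test[OF _ s]) auto
qed

lemma shift_op_in_ell2: "x \<in> ell2 \<Longrightarrow> shift_op x \<in> ell2"
  unfolding ell2_def shift_op_def
  by (auto simp flip: summable_Suc_iff[of "\<lambda>n. (cmod (if n = 0 then 0 else x (n - 1)))\<^sup>2"])

lemma diag_op_in_ell2:
  assumes pos: "\<And>n. n \<ge> 1 \<Longrightarrow> a n > 0"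
    and lim: "(\<lambda>n. a (Suc n) / a n) \<longlonglongrightarrow> 0"
    and x: "x \<in> ell2"
  shows "diag_op a x \<in> ell2"
proof -
  have "eventually (\<lambda>n. a (Suc n) / a n < 1) sequentially"
    using lim by (rule order_tendstoD) simp
  then obtain N0 where N0: "\<And>n. n \<ge> N0 \<Longrightarrow> a (Suc n) / a n < 1"
    by (auto simp: eventually_sequentially)
  define N where "N = max N0 1"
  have step: "a (Suc n) \<le> a n" if "n \<ge> N" for n
    using N0[of n] pos[of n] that by (auto simp: N_def field_simps)
  have le: "a n \<le> a N" if "n \<ge> N" for n
    using that
  proof (induction n rule: dec_induct)
    case (step m)
    then show ?case using \<open>\<And>n. n \<ge> N \<Longrightarrow> a (Suc n) \<le> a n\<close>[of m] by linarith
  qed simp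
  have bnd: "(cmod (diag_op a x n))\<^sup>2 \<le> (a N)\<^sup>2 * (cmod (x n))\<^sup>2" if "n \<ge> N" for n
  proof -
    have "0 < a n" using pos that by (simp add: N_def)
    then have "(a n)\<^sup>2 \<le> (a N)\<^sup>2" using le[OF that] by (intro power_mono) auto
    then show ?thesis
      by (simp add: diag_op_def norm_mult power_mult_distrib mult_right_mono)
  qed
  have s: "summable (\<lambda>n. (a N)\<^sup>2 * (cmod (x n))\<^sup>2)"
    using x by (intro summable_mult) (auto simp: ell2_def)
  have "summable (\<lambda>n. (cmod (diag_op a x n))\<^sup>2)"
    using bnd by (intro summable_comparison_test[OF _ s]) auto
  with x show ?thesis by (auto simp: ell2_def diag_op_def)
qed

lemma ell2_inner_basis_left: "ell2_inner (basis_vec k) y = cnj (y k)"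
proof -
  have "ell2_inner (basis_vec k) y = (\<Sum>n\<in>{k}. basis_vec k n * cnj (y n))"
    unfolding ell2_inner_def by (rule suminf_finite) (auto simp: basis_vec_def)
  then show ?thesis by (simp add: basis_vec_def)
qed

lemma adjoint_op_eqI:
  assumes T': "T' \<in> ell2 \<rightarrow>\<^sub>E ell2"
    and adj: "\<And>x y. x \<in> ell2 \<Longrightarrow> y \<in> ell2 \<Longrightarrow> ell2_inner (T x) y = ell2_inner x (T' y)"
  shows "adjoint_op T = T'"
  unfolding adjoint_op_def
proof (rule the_equality)
  fix T''
  assume *: "T'' \<in> ell2 \<rightarrow>\<^sub>E ell2 \<and>
    (\<forall>x\<in>ell2. \<forall>y\<in>ell2. ell2_inner (T x) y = ell2_inner x (T'' y))"
  show "T'' = T'"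
  proof (rule PiE_ext)
    fix y assume y: "y \<in> ell2"
    have "T'' y k = T' y k" for k
    proof (cases "k = 0")
      case True
      have "T'' y \<in> ell2" "T' y \<in> ell2" using * T' y by auto
      then show ?thesis using True by (simp add: ell2_def)
    next
      case False
      then have k: "basis_vec k \<in> ell2" by (intro basis_vec_in_ell2) auto
      have "ell2_inner (basis_vec k) (T'' y) = ell2_inner (basis_vec k) (T' y)"
        using * adj[OF k y] k y by metis
      then show ?thesis by (simp add: ell2_inner_basis_left)
    qed
    then show "T'' y = T' y" by blast
  qed (use * T' in auto)
qed (use T' adj in auto)

lemma adjoint_shift_op:
  "adjoint_op shift_op = (\<lambda>y\<in>ell2. \<lambda>n. if n = 0 then 0 else y (Suc n))"
proof (rule adjoint_op_eqI)
  have "(\<lambda>n. if n = 0 then 0 else y (Suc n)) \<in> ell2" if "y \<in> ell2" for y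
  proof -
    have "summable (\<lambda>n. (cmod (y (Suc (Suc n))))\<^sup>2)"
      using that summable_iff_shift[of "\<lambda>n. (cmod (y n))\<^sup>2" 2] by (simp add: ell2_def)
    then show ?thesis
      unfolding ell2_def
      by (auto simp flip:
          summable_Suc_iff[of "\<lambda>n. (cmod (if n = 0 then 0 else y (Suc n)))\<^sup>2"])
  qed
  then show "(\<lambda>y\<in>ell2. \<lambda>n. if n = 0 then 0 else y (Suc n)) \<in> ell2 \<rightarrow>\<^sub>E ell2" by auto
next
  fix x y assume x: "x \<in> ell2" and y: "y \<in> ell2"
  have "ell2_inner (shift_op x) y = (\<Sum>n. x n * cnj (y (Suc n)))"
    unfolding ell2_inner_def
    using suminf_split_head[OF ell2_inner_summable[OF shift_op_in_ell2[OF x] y]]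
    by (simp add: shift_op_def)
  also have "\<dots> = (\<Sum>n. x n * cnj (if n = 0 then 0 else y (Suc n)))"
    using x by (intro suminf_cong) (auto simp: ell2_def)
  finally show "ell2_inner (shift_op x) y =
      ell2_inner x ((\<lambda>y\<in>ell2. \<lambda>n. if n = 0 then 0 else y (Suc n)) y)"
    using y by (simp add: ell2_inner_def)
qed

lemma adjoint_shift_op_apply:
  "y \<in> ell2 \<Longrightarrow> adjoint_op shift_op y n = (if n = 0 then 0 else y (Suc n))"
  by (simp add: adjoint_shift_op)

lemma adjoint_shift_op_in_ell2: "y \<in> ell2 \<Longrightarrow> adjoint_op shift_op y \<in> ell2"
proof -
  assume y: "y \<in> ell2"
  have "summable (\<lambda>n. (cmod (y (Suc n)))\<^sup>2)"
    using y summable_Suc_iff[of "\<lambda>n. (cmod (y n))\<^sup>2"] by (simp add: ell2_def)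
  then have "summable (\<lambda>n. (cmod (adjoint_op shift_op y n))\<^sup>2)"
    by (rule summable_comparison_test[rotated]) (auto simp: adjoint_shift_op_apply[OF y])
  then show ?thesis by (simp add: ell2_def adjoint_shift_op_apply[OF y])
qed

lemma jacobi_op_in_ell2:
  assumes "\<And>n. n \<ge> 1 \<Longrightarrow> a n > 0" "(\<lambda>n. a (Suc n) / a n) \<longlonglongrightarrow> 0" "x \<in> ell2"
  shows "jacobi_op a x \<in> ell2"
  unfolding jacobi_op_def using assms
  by (intro ell2_add shift_op_in_ell2 diag_op_in_ell2 adjoint_shift_op_in_ell2) auto

lemma shift_op_basis: "shift_op (basis_vec k) = basis_vec (Suc k)"
  by (auto simp: fun_eq_iff shift_op_def basis_vec_def)

lemma diag_op_basis: "diag_op a (basis_vec k) = (\<lambda>n. a k * basis_vec k n)"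
  by (auto simp: diag_op_def basis_vec_def)

lemma jacobi_op_basis_1: "jacobi_op a (basis_vec 1) = (\<lambda>n. a 1 * basis_vec 2 n)"
  using basis_vec_in_ell2[of 1]
  by (auto simp: fun_eq_iff jacobi_op_def shift_op_def diag_op_def basis_vec_def
      adjoint_shift_op_apply)

lemma jacobi_op_basis:
  assumes "k \<ge> 2"
  shows "jacobi_op a (basis_vec k) =
    (\<lambda>n. a (k - 1) * basis_vec (k - 1) n + a k * basis_vec (k + 1) n)"
  using basis_vec_in_ell2[of k] assms
  by (auto simp: fun_eq_iff jacobi_op_def shift_op_def diag_op_def basis_vec_def
      adjoint_shift_op_apply)

end

theory Submission
  imports Defs
begin

text \<open>
  Upper bound (min-max): some nontrivial combination of the first \<open>n\<close> eigenvectors has vanishing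
  coordinates \<open>2, 4, \<dots>, 2n - 2\<close>, and on such vectors the quadratic form of \<open>J\<close> only involves
  \<open>a (2n - 1), a (2n), \<dots>\<close>, hence \<open>lam n \<le> a (2n - 1) + a (2n)\<close> for large \<open>n\<close>.

  Lower bound (Sturm oscillation): the solution decaying at infinity of the eigenvalue recurrence is,
  up to nonzero factors, a sequence \<open>F m\<close> of continuous functions of \<open>z = 1 / \<mu>\<^sup>2\<close> with
  \<open>F m = F (m + 1) - z (a (m + 1))\<^sup>2 F (m + 2)\<close> and \<open>F m \<longrightarrow> 1\<close>; its zeros \<open>F 0 = 0\<close> give
  eigenvalues. All \<open>F m\<close> are \<open>1\<close> at \<open>z = 0\<close>, while at \<open>\<mu> = (1 - \<epsilon>) a (2n - 1)\<close> with \<open>n\<close> large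
  the members \<open>F (2j)\<close> and \<open>F (2j + 1)\<close> have opposite signs for all \<open>j < n\<close>. The number of sign
  changes of the chain only moves where \<open>F 0\<close> vanishes, and by at most one there, so there are at
  least \<open>n\<close> eigenvalues above \<open>(1 - \<epsilon>) a (2n - 1)\<close>.
\<close>

section \<open>Eigenvectors and the min-max bound\<close>

text \<open>Gaussian elimination, one equation \<open>j0\<close> at a time: a pivot \<open>p\<close>
  with \<open>v p j0 \<noteq> 0\<close> clears \<open>j0\<close> from the other unknowns.\<close>

lemma underdetermined_system_nontrivial_solution:
  fixes v :: "'i \<Rightarrow> 'j \<Rightarrow> 'a::field"
  assumes "finite J" "finite I" "card J < card I"
  shows "\<exists>c. (\<exists>i\<in>I. c i \<noteq> 0) \<and> (\<forall>j\<in>J. (\<Sum>i\<in>I. c i * v i j) = 0)"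
  using assms
proof (induction J arbitrary: I v rule: finite_induct)
  case empty
  then have "I \<noteq> {}" by auto
  then show ?case by (intro exI[of _ "\<lambda>_. 1"]) auto
next
  case (insert j0 J)
  show ?case
  proof (cases "\<forall>i\<in>I. v i j0 = 0")
    case True
    have "card J < card I" using insert by auto
    from insert.IH[OF insert.prems(1) this, of v] obtain c where
      "\<exists>i\<in>I. c i \<noteq> 0" "\<forall>j\<in>J. (\<Sum>i\<in>I. c i * v i j) = 0" by blast
    then show ?thesis using True by (intro exI[of _ c]) simp
  next
    case False
    then obtain p where p: "p \<in> I" "v p j0 \<noteq> 0" by blast
    define v' where "v' = (\<lambda>i j. v i j - v i j0 / v p j0 * v p j)"
    have "card J < card (I - {p})" "finite (I - {p})"
      using insert p by auto
    from insert.IH[OF this(2,1), of v'] obtain c where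
      c: "\<exists>i\<in>I - {p}. c i \<noteq> 0" "\<And>j. j \<in> J \<Longrightarrow> (\<Sum>i\<in>I - {p}. c i * v' i j) = 0"
      by blast
    \<comment> \<open>The pivot coefficient is the one that equation \<open>j0\<close> forces, given
      the others.\<close>
    define c' where "c' = c(p := - (\<Sum>i\<in>I - {p}. c i * v i j0 / v p j0))"
    have split: "(\<Sum>i\<in>I. c' i * v i j) = (\<Sum>i\<in>I - {p}. c i * v' i j)" for j
    proof -
      have "(\<Sum>i\<in>I. c' i * v i j) = c' p * v p j + (\<Sum>i\<in>I - {p}. c' i * v i j)"
        using p insert.prems by (simp add: sum.remove)
      also have "(\<Sum>i\<in>I - {p}. c' i * v i j) = (\<Sum>i\<in>I - {p}. c i * v i j)"
        by (intro sum.cong) (auto simp: c'_def)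
      also have "c' p * v p j = - (\<Sum>i\<in>I - {p}. c i * (v i j0 / v p j0 * v p j))"
        by (simp add: c'_def sum_distrib_right mult.assoc)
      finally show ?thesis
        by (simp add: v'_def right_diff_distrib sum_subtractf)
    qed
    have "(\<Sum>i\<in>I. c' i * v i j) = 0" if "j \<in> insert j0 J" for j
      using that c(2) p by (auto simp: split) (simp add: v'_def)
    moreover have "\<exists>i\<in>I. c' i \<noteq> 0" using c(1) by (auto simp: c'_def)
    ultimately show ?thesis by blast
  qed
qed

section \<open>Eigenvalue recurrence and orthogonality of eigenvectors\<close>

text \<open>The recurrence is row \<open>Suc n\<close> of the eigenvalue equation. Since
  \<open>x 0 = 0\<close>, the case \<open>n = 0\<close> is the first row of the matrix, and row 0 is
  trivial.\<close>

lemma positive_eigenvalues_jacobi_op_iff: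
  "\<mu> \<in> positive_eigenvalues (jacobi_op a) \<longleftrightarrow>
    0 < \<mu> \<and> (\<exists>x\<in>ell2. x \<noteq> (\<lambda>n. 0) \<and>
      (\<forall>n. a n * x n + a (Suc n) * x (Suc (Suc n)) = \<mu> * x (Suc n)))"
proof -
  have all_nat_split: "(\<forall>n. P n) \<longleftrightarrow> P 0 \<and> (\<forall>n. P (Suc n))" for P :: "nat \<Rightarrow> bool"
    by (metis not0_implies_Suc)
  have "jacobi_op a x = (\<lambda>n. \<mu> * x n) \<longleftrightarrow>
      (\<forall>n. a n * x n + a (Suc n) * x (Suc (Suc n)) = \<mu> * x (Suc n))" if x: "x \<in> ell2"
    for x :: "nat \<Rightarrow> complex"
  proof -
    have "jacobi_op a x 0 = \<mu> * x 0"
      using x by (simp add: jacobi_op_def shift_op_def diag_op_def adjoint_shift_op_apply ell2_def)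
    moreover have "jacobi_op a x (Suc n) = a n * x n + a (Suc n) * x (Suc (Suc n))" for n
      using x by (simp add: jacobi_op_def shift_op_def diag_op_def adjoint_shift_op_apply)
    ultimately show ?thesis
      unfolding fun_eq_iff by (subst all_nat_split) simp
  qed
  then show ?thesis
    by (auto simp: positive_eigenvalues_def point_spectrum_def)
qed

lemma ell2_tendsto_zero:
  assumes "x \<in> ell2" shows "x \<longlonglongrightarrow> 0"
proof -
  have "(\<lambda>n. (cmod (x n))\<^sup>2) \<longlonglongrightarrow> 0"
    using assms by (intro summable_LIMSEQ_zero) (simp add: ell2_def)
  then have "(\<lambda>n. sqrt ((cmod (x n))\<^sup>2)) \<longlonglongrightarrow> sqrt 0" by (rule tendsto_real_sqrt)
  then show ?thesis by (simp add: tendsto_norm_zero_iff)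
qed

text \<open>Discrete Green identity: the partial sums of the inner product, multiplied by
  \<open>\<mu> - \<nu>\<close>, telescope to a Wronskian at \<open>N\<close> weighted by
  \<open>a N\<close>, which tends to 0.\<close>

lemma jacobi_eigenvectors_orthogonal:
  fixes \<mu> \<nu> :: real and x y :: "nat \<Rightarrow> complex"
  assumes a: "a \<longlonglongrightarrow> 0" and x: "x \<in> ell2" and y: "y \<in> ell2" and ne: "\<mu> \<noteq> \<nu>"
    and eqx: "\<And>n. complex_of_real (a n) * x n + a (Suc n) * x (Suc (Suc n)) = \<mu> * x (Suc n)"
    and eqy: "\<And>n. complex_of_real (a n) * y n + a (Suc n) * y (Suc (Suc n)) = \<nu> * y (Suc n)"
  shows "ell2_inner x y = 0"
proof -
  have x0: "x 0 = 0" and y0: "y 0 = 0" using x y by (auto simp: ell2_def)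
  have eqy': "complex_of_real (a n) * cnj (y n) + a (Suc n) * cnj (y (Suc (Suc n)))
      = \<nu> * cnj (y (Suc n))" for n
    using arg_cong[OF eqy[of n], of cnj] by simp
  have green: "(complex_of_real \<mu> - \<nu>) * (\<Sum>m\<le>N. x m * cnj (y m)) =
      a N * (x (Suc N) * cnj (y N) - x N * cnj (y (Suc N)))" for N
  proof (induction N)
    case (Suc N)
    have "(complex_of_real \<mu> - \<nu>) * (x (Suc N) * cnj (y (Suc N))) =
        (\<mu> * x (Suc N)) * cnj (y (Suc N)) - x (Suc N) * (\<nu> * cnj (y (Suc N)))"
      by (simp add: algebra_simps)
    also have "\<dots> = (a N * x N + a (Suc N) * x (Suc (Suc N))) * cnj (y (Suc N))
        - x (Suc N) * (a N * cnj (y N) + a (Suc N) * cnj (y (Suc (Suc N))))"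
      by (simp only: eqx eqy')
    finally have *: "(complex_of_real \<mu> - \<nu>) * (x (Suc N) * cnj (y (Suc N))) = \<dots>" .
    show ?case
      unfolding sum.atMost_Suc distrib_left Suc.IH * by (simp add: algebra_simps)
  qed (simp add: x0 y0)
  have tx: "x \<longlonglongrightarrow> 0" and ty: "y \<longlonglongrightarrow> 0" using x y by (auto intro: ell2_tendsto_zero)
  have "(\<lambda>N. a N * (x (Suc N) * cnj (y N) - x N * cnj (y (Suc N)))) \<longlonglongrightarrow>
      complex_of_real 0 * (0 * cnj 0 - 0 * cnj 0)"
    by (intro tendsto_intros LIMSEQ_Suc tx ty a)
  moreover have "(\<lambda>N. (complex_of_real \<mu> - \<nu>) * (\<Sum>m\<le>N. x m * cnj (y m))) \<longlonglongrightarrow>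
      (complex_of_real \<mu> - \<nu>) * ell2_inner x y"
    unfolding ell2_inner_def
    using summable_LIMSEQ'[OF ell2_inner_summable[OF x y]] by (intro tendsto_intros)
  ultimately have "(complex_of_real \<mu> - \<nu>) * ell2_inner x y = 0"
    unfolding green using LIMSEQ_unique by fastforce
  then show ?thesis using ne by simp
qed

text \<open>Orthogonality kills the cross terms. The choice \<open>d = c\<close> yields the squared
  norm of the combination, and \<open>d i = c i * lam i\<close> the quadratic form of
  \<open>J\<close> on it.\<close>

lemma sums_orthogonal_combination:
  fixes c d :: "'i \<Rightarrow> complex"
  assumes I: "finite I" and x: "\<And>i. i \<in> I \<Longrightarrow> x i \<in> ell2"
    and orth: "\<And>i j. i \<in> I \<Longrightarrow> j \<in> I \<Longrightarrow> i \<noteq> j \<Longrightarrow> ell2_inner (x i) (x j) = 0"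
  shows "(\<lambda>m. (\<Sum>i\<in>I. d i * x i m) * cnj (\<Sum>i\<in>I. c i * x i m)) sums
    (\<Sum>i\<in>I. d i * cnj (c i) * ell2_inner (x i) (x i))"
proof -
  have "(\<lambda>m. x i m * cnj (x j m)) sums ell2_inner (x i) (x j)" if "i \<in> I" "j \<in> I" for i j
    unfolding ell2_inner_def using that x by (intro summable_sums ell2_inner_summable)
  then have "(\<lambda>m. \<Sum>i\<in>I. \<Sum>j\<in>I. d i * cnj (c j) * (x i m * cnj (x j m))) sums
      (\<Sum>i\<in>I. \<Sum>j\<in>I. d i * cnj (c j) * ell2_inner (x i) (x j))"
    by (intro sums_sum sums_mult)
  moreover have "(\<Sum>i\<in>I. \<Sum>j\<in>I. d i * cnj (c j) * ell2_inner (x i) (x j)) =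
      (\<Sum>i\<in>I. \<Sum>j\<in>I. if j = i then d i * cnj (c i) * ell2_inner (x i) (x i) else 0)"
    by (intro sum.cong) (auto simp: orth)
  moreover have "\<dots> = (\<Sum>i\<in>I. d i * cnj (c i) * ell2_inner (x i) (x i))"
    using I by (intro sum.cong) auto
  moreover have "(\<Sum>i\<in>I. d i * x i m) * cnj (\<Sum>i\<in>I. c i * x i m) =
      (\<Sum>i\<in>I. \<Sum>j\<in>I. d i * cnj (c j) * (x i m * cnj (x j m)))" for m
    by (simp add: sum_product mult_ac)
  ultimately show ?thesis by simp
qed

section \<open>The quadratic form and the upper bound on eigenvalues\<close>

text \<open>Here \<open>w\<close> plays \<open>J y\<close>. The left side is twice the sum of
  \<open>a m * Re (y (Suc m) * cnj (y m))\<close> over \<open>m \<le> N\<close>, where only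
  \<open>m \<ge> k\<close> survive. Splitting each product into squares gives every squared
  coordinate a weight of at most two neighbouring members of \<open>a\<close>. The boundary terms at
  \<open>N\<close> close the induction and vanish in the limit.\<close>

lemma jacobi_form_upper_bound:
  fixes y w :: "nat \<Rightarrow> complex"
  assumes pos: "\<And>n. n \<ge> k \<Longrightarrow> a n > 0" and dec: "\<And>n. n \<ge> k \<Longrightarrow> a (Suc n) \<le> a n"
    and y0: "y 0 = 0"
    and w: "\<And>n. w (Suc n) = a n * y n + a (Suc n) * y (Suc (Suc n))"
    and van: "\<And>m. m < k \<Longrightarrow> y (Suc m) * cnj (y m) = 0"
    and N: "N \<ge> k"
  shows "(\<Sum>m\<le>N. Re (w m * cnj (y m))) + a N * Re (y (Suc N) * cnj (y N)) \<le>
    (a k + a (Suc k)) * (\<Sum>m\<le>N. (cmod (y m))\<^sup>2) + a N * (cmod (y (Suc N)))\<^sup>2"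
proof -
  define t where "t = (\<lambda>m. a m * Re (y (Suc m) * cnj (y m)))"
  have t_eq: "a m * Re (y (Suc m) * cnj (y m)) = t m" for m by (simp add: t_def)
  have w_step: "Re (w (Suc m) * cnj (y (Suc m))) = t m + t (Suc m)" for m
    by (simp add: w t_def algebra_simps)
  have t_le: "2 * t m \<le> a m * ((cmod (y m))\<^sup>2 + (cmod (y (Suc m)))\<^sup>2)" if "m \<ge> k" for m
  proof -
    have "2 * Re (y (Suc m) * cnj (y m)) \<le> 2 * (cmod (y m) * cmod (y (Suc m)))"
      using complex_Re_le_cmod[of "y (Suc m) * cnj (y m)"] by (simp add: norm_mult mult.commute)
    also have "\<dots> \<le> (cmod (y m))\<^sup>2 + (cmod (y (Suc m)))\<^sup>2"
      using sum_squares_bound[of "cmod (y m)" "cmod (y (Suc m))"] by simp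
    finally have "a m * (2 * Re (y (Suc m) * cnj (y m))) \<le>
        a m * ((cmod (y m))\<^sup>2 + (cmod (y (Suc m)))\<^sup>2)"
      using pos[OF that] by (intro mult_left_mono) auto
    then show ?thesis by (simp add: t_def algebra_simps)
  qed
  have tz: "t m = 0" if "m < k" for m unfolding t_def van[OF that] by simp
  have a_le: "a m \<le> a n" if "k \<le> n" "n \<le> m" for m n
    using that(2,1)
  proof (induction m rule: dec_induct)
    case (step m)
    then show ?case using dec[of m] by linarith
  qed simp
  from N show ?thesis
    unfolding t_eq
  proof (induction N rule: dec_induct)
    case base
    have E: "(\<Sum>m\<le>M. Re (w m * cnj (y m))) = t M" if "M \<le> k" for M
      using that
    proof (induction M)
      case (Suc M)
      then show ?case using tz[of M] by (simp add: w_step del: Re_complex_of_real times_complex.sel)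
    qed (simp add: y0 t_def)
    have "(cmod (y k))\<^sup>2 \<le> (\<Sum>m\<le>k. (cmod (y m))\<^sup>2)"
      by (rule member_le_sum) auto
    then have "a k * (cmod (y k))\<^sup>2 \<le> (a k + a (Suc k)) * (\<Sum>m\<le>k. (cmod (y m))\<^sup>2)"
      using pos[of k] pos[of "Suc k"] by (intro mult_mono) auto
    then show ?case using t_le[of k] E[of k] by (simp add: algebra_simps)
  next
    case (step N)
    \<comment> \<open>Coordinate \<open>Suc N\<close> meets the weights \<open>a N\<close> and
      \<open>a (Suc N)\<close>; this pair is largest at \<open>N = k\<close>.\<close>
    have "a N + a (Suc N) \<le> a k + a (Suc k)"
    proof (cases "N = k")
      case False
      then show ?thesis
        using a_le[of "Suc k" N] a_le[of k "Suc N"] step.hyps by simp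
    qed simp
    then have "(a N + a (Suc N)) * (cmod (y (Suc N)))\<^sup>2 \<le> (a k + a (Suc k)) * (cmod (y (Suc N)))\<^sup>2"
      by (intro mult_right_mono) auto
    then show ?case
      using step.IH t_le[of "Suc N"] step.hyps
      by (simp add: w_step algebra_simps
          del: times_complex.sel)
  qed
qed

lemma eigenvalue_upper_bound:
  fixes lam :: "nat \<Rightarrow> real"
  assumes n: "n \<ge> 1" and a: "a \<longlonglongrightarrow> 0"
    and pos: "\<And>m. m \<ge> 2 * n - 1 \<Longrightarrow> a m > 0"
    and dec: "\<And>m. m \<ge> 2 * n - 1 \<Longrightarrow> a (Suc m) \<le> a m"
    and ev: "\<And>i. 1 \<le> i \<Longrightarrow> i \<le> n \<Longrightarrow> lam i \<in> positive_eigenvalues (jacobi_op a)"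
    and lam_decreasing: "\<And>i j. 1 \<le> i \<Longrightarrow> i < j \<Longrightarrow> lam j < lam i"
  shows "lam n \<le> a (2 * n - 1) + a (2 * n)"
proof -
  define I where "I = {1..n}"
  define k where "k = 2 * n - 1"
  have "\<forall>i\<in>I. \<exists>x::nat \<Rightarrow> complex. x \<in> ell2 \<and> x \<noteq> (\<lambda>n. 0) \<and>
      (\<forall>n. a n * x n + a (Suc n) * x (Suc (Suc n)) = lam i * x (Suc n))"
    using ev unfolding positive_eigenvalues_jacobi_op_iff I_def Bex_def by simp
  from bchoice[OF this] obtain x :: "nat \<Rightarrow> nat \<Rightarrow> complex" where x: "\<And>i. i \<in> I \<Longrightarrow> x i \<in> ell2"
    and x_ne: "\<And>i. i \<in> I \<Longrightarrow> x i \<noteq> (\<lambda>n. 0)"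
    and eqx: "\<And>i n. i \<in> I \<Longrightarrow>
      complex_of_real (a n) * x i n + a (Suc n) * x i (Suc (Suc n)) = lam i * x i (Suc n)"
    by blast
  have orth: "ell2_inner (x i) (x j) = 0" if "i \<in> I" "j \<in> I" "i \<noteq> j" for i j
  proof -
    have "lam i \<noteq> lam j"
      using that lam_decreasing[of i j] lam_decreasing[of j i] by (cases i j rule: linorder_cases) (auto simp: I_def)
    from jacobi_eigenvectors_orthogonal[OF a x[OF that(1)] x[OF that(2)] this
        eqx[OF that(1)] eqx[OF that(2)]] show ?thesis .
  qed
  define Q where "Q = (\<lambda>i. \<Sum>m. (cmod (x i m))\<^sup>2)"
  have sq: "(\<lambda>m. (cmod (x i m))\<^sup>2) sums Q i" if "i \<in> I" for i
    unfolding Q_def using x[OF that] by (intro summable_sums) (simp add: ell2_def)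
  have Q: "ell2_inner (x i) (x i) = of_real (Q i)" if "i \<in> I" for i
    using sums_of_real[OF sq[OF that], where 'a = complex]
    unfolding ell2_inner_def by (simp add: sums_iff complex_norm_square del: of_real_power)
  have Q_pos: "Q i > 0" if i: "i \<in> I" for i
  proof -
    obtain m where "x i m \<noteq> 0" using x_ne[OF i] by auto
    then show ?thesis
      unfolding Q_def using sq[OF i] by (intro suminf_pos2[of _ m]) (auto simp: sums_iff)
  qed
  \<comment> \<open>There are \<open>n\<close> unknowns against the \<open>n - 1\<close> conditions
    at coordinates \<open>2, 4, \<dots>, 2n - 2\<close>.\<close>
  obtain c where c: "\<exists>i\<in>I. c i \<noteq> 0" "\<And>j. j \<in> {1..<n} \<Longrightarrow> (\<Sum>i\<in>I. c i * x i (2 * j)) = 0"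
    using underdetermined_system_nontrivial_solution[of "{1..<n}" I "\<lambda>i j. x i (2 * j)"] n
    unfolding I_def by fastforce
  define y where "y = (\<lambda>m. \<Sum>i\<in>I. c i * x i m)"
  \<comment> \<open>\<open>w\<close> is \<open>J y\<close>; below, \<open>Y\<close> is the squared
    norm of \<open>y\<close> and \<open>W\<close> the quadratic form of \<open>J\<close> at
    \<open>y\<close>.\<close>
  define w where "w = (\<lambda>m. \<Sum>i\<in>I. (c i * lam i) * x i m)"
  define Y where "Y = (\<Sum>i\<in>I. (cmod (c i))\<^sup>2 * Q i)"
  define W where "W = (\<Sum>i\<in>I. lam i * ((cmod (c i))\<^sup>2 * Q i))"
  have fin: "finite I" by (simp add: I_def)
  have comb: "(\<lambda>m. (\<Sum>i\<in>I. d i * x i m) * cnj (\<Sum>i\<in>I. c i * x i m)) sums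
      (\<Sum>i\<in>I. d i * cnj (c i) * ell2_inner (x i) (x i))" for d
    by (rule sums_orthogonal_combination[OF fin]) (fact x orth)+
  have "(\<Sum>i\<in>I. c i * cnj (c i) * ell2_inner (x i) (x i)) = of_real Y"
    unfolding Y_def of_real_sum
    by (intro sum.cong refl) (simp add: Q complex_norm_square del: complex_mult_cnj of_real_power)
  then have "(\<lambda>m. y m * cnj (y m)) sums of_real Y"
    using comb[of c] by (simp only: y_def)
  from sums_Re[OF this] have Y: "(\<lambda>m. (cmod (y m))\<^sup>2) sums Y"
    unfolding cmod_power2 by (simp add: power2_eq_square)
  have "(\<Sum>i\<in>I. (c i * lam i) * cnj (c i) * ell2_inner (x i) (x i)) =
      (\<Sum>i\<in>I. lam i * (c i * cnj (c i) * ell2_inner (x i) (x i)))"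
    by (simp add: mult_ac)
  also have "\<dots> = of_real W"
    unfolding W_def of_real_sum
    by (intro sum.cong refl) (simp add: Q complex_norm_square del: complex_mult_cnj of_real_power)
  finally have "(\<lambda>m. w m * cnj (y m)) sums of_real W"
    using comb[of "\<lambda>i. c i * lam i"]
    by (simp only: y_def w_def)
  from sums_Re[OF this] have W: "(\<lambda>m. Re (w m * cnj (y m))) sums W" by simp
  have y0: "y 0 = 0" using x by (simp add: y_def ell2_def)
  have rec: "w (Suc m) = a m * y m + a (Suc m) * y (Suc (Suc m))" for m
  proof -
    have "w (Suc m) = (\<Sum>i\<in>I. c i * (lam i * x i (Suc m)))"
      by (simp add: w_def mult_ac)
    also have "\<dots> = (\<Sum>i\<in>I. c i * (a m * x i m + a (Suc m) * x i (Suc (Suc m))))"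
      by (intro sum.cong) (auto simp: eqx)
    finally show ?thesis by (simp add: y_def sum_distrib_left sum.distrib algebra_simps)
  qed
  have y_even: "y (2 * j) = 0" if "j < n" for j
    using that c(2)[of j] y0 by (cases "j = 0") (auto simp: y_def)
  \<comment> \<open>One of \<open>m\<close> and \<open>Suc m\<close> is even, and it is at most
    \<open>2 * n - 2\<close>.\<close>
  have van: "y (Suc m) * cnj (y m) = 0" if "m < k" for m
  proof (cases "even m")
    case True
    then obtain j where "m = 2 * j" by blast
    then show ?thesis using that y_even[of j] by (auto simp: k_def)
  next
    case False
    then obtain j where j: "m = 2 * j + 1" using oddE by blast
    then have "Suc m = 2 * (j + 1)" "j + 1 < n" using that by (auto simp: k_def)
    then show ?thesis using y_even[of "j + 1"] by simp
  qed
  have ty: "y \<longlonglongrightarrow> 0"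
  proof -
    have "y \<in> ell2" using Y y0 by (auto simp: ell2_def sums_iff)
    then show ?thesis by (rule ell2_tendsto_zero)
  qed
  have "(\<lambda>N. (\<Sum>m\<le>N. Re (w m * cnj (y m))) + a N * Re (y (Suc N) * cnj (y N))) \<longlonglongrightarrow>
      W + 0 * Re (0 * cnj 0)"
    using W unfolding sums_def_le
    by (intro tendsto_add tendsto_mult tendsto_Re tendsto_cnj LIMSEQ_Suc ty a)
  moreover have "(\<lambda>N. (a k + a (Suc k)) * (\<Sum>m\<le>N. (cmod (y m))\<^sup>2) + a N * (cmod (y (Suc N)))\<^sup>2)
      \<longlonglongrightarrow> (a k + a (Suc k)) * Y + 0 * (cmod 0)\<^sup>2"
    using Y unfolding sums_def_le
    by (intro tendsto_add tendsto_mult tendsto_norm tendsto_const tendsto_power LIMSEQ_Suc ty a)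
  moreover have "\<forall>N\<ge>k. (\<Sum>m\<le>N. Re (w m * cnj (y m))) + a N * Re (y (Suc N) * cnj (y N)) \<le>
    (a k + a (Suc k)) * (\<Sum>m\<le>N. (cmod (y m))\<^sup>2) + a N * (cmod (y (Suc N)))\<^sup>2"
    using pos dec van by (intro allI impI jacobi_form_upper_bound rec y0) (auto simp: k_def)
  ultimately have WY: "W \<le> (a k + a (Suc k)) * Y"
    using LIMSEQ_le by fastforce
  \<comment> \<open>Among the eigenvalues entering \<open>W\<close> the smallest is
    \<open>lam n\<close>, so \<open>W\<close> is at least \<open>lam n * Y\<close>.\<close>
  have "lam n \<le> lam i" if "i \<in> I" for i
    using that lam_decreasing[of i n] by (cases "i = n") (auto simp: I_def)
  then have "lam n * Y \<le> W"
    unfolding W_def Y_def sum_distrib_left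
    using Q_pos by (intro sum_mono mult_right_mono mult_nonneg_nonneg) (auto intro: less_imp_le)
  moreover have "Y > 0"
    unfolding Y_def using c(1) Q_pos fin
    by (auto intro!: sum_pos2 mult_pos_pos mult_nonneg_nonneg simp: less_imp_le)
  ultimately have "lam n \<le> a k + a (Suc k)"
    using WY by (metis mult_le_cancel_right_pos order_trans)
  then show ?thesis using n by (simp add: k_def)
qed

section \<open>Sturm chains\<close>

text \<open>Zero is grouped with the negative values, which keeps the count meaningful where a
  member vanishes. The start index \<open>i\<close> varies for the sake of induction towards
  \<open>N\<close>.\<close>

definition sign_changes :: "nat \<Rightarrow> (nat \<Rightarrow> real) \<Rightarrow> nat \<Rightarrow> nat" where
  "sign_changes N s i = (\<Sum>m\<in>{i..<N}. of_bool ((s m > 0) \<noteq> (s (Suc m) > 0)))"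

lemma sign_changes_step:
  "i < N \<Longrightarrow> sign_changes N s i = of_bool ((s i > 0) \<noteq> (s (Suc i) > 0)) + sign_changes N s (Suc i)"
  unfolding sign_changes_def by (subst sum.atLeast_Suc_lessThan) auto

lemma eventually_same_sign:
  fixes g :: "real \<Rightarrow> real"
  assumes "isCont g \<zeta>" "g \<zeta> \<noteq> 0"
  shows "eventually (\<lambda>z. (g z > 0) = (g \<zeta> > 0)) (nhds \<zeta>)"
proof -
  have lim: "(g \<longlongrightarrow> g \<zeta>) (nhds \<zeta>)" using assms(1) by (simp add: isCont_def tendsto_at_iff_tendsto_nhds)
  show ?thesis
  proof (cases "g \<zeta> > 0")
    case True
    then show ?thesis using order_tendstoD(1)[OF lim True] by (auto elim: eventually_mono)
  next
    case False
    then have neg: "g \<zeta> < 0" using assms(2) by auto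
    then show ?thesis using order_tendstoD(2)[OF lim neg] by (auto elim!: eventually_mono)
  qed
qed

text \<open>An interior member of the chain does not affect the count where it vanishes, because its two
  neighbours have opposite signs there.\<close>

lemma sign_changes_locally_constant:
  fixes f :: "nat \<Rightarrow> real \<Rightarrow> real"
  assumes cont: "\<And>m. isCont (f m) \<zeta>"
    and alt: "\<And>m. f (Suc m) \<zeta> = 0 \<Longrightarrow> f m \<zeta> * f (Suc (Suc m)) \<zeta> < 0"
    and last: "f N \<zeta> \<noteq> 0" and "i \<le> N" and "f i \<zeta> \<noteq> 0"
  shows "eventually (\<lambda>z. sign_changes N (\<lambda>m. f m z) i = sign_changes N (\<lambda>m. f m \<zeta>) i) (nhds \<zeta>)"
  using assms(4,5)
proof (induction "N - i" arbitrary: i rule: less_induct)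
  case less
  show ?case
  proof (cases "i = N")
    case True
    then show ?thesis by (simp add: sign_changes_def)
  next
    case False
    then have i: "i < N" using less.prems by simp
    show ?thesis
    proof (cases "f (Suc i) \<zeta> = 0")
      case False
      have "eventually (\<lambda>z. sign_changes N (\<lambda>m. f m z) (Suc i) =
          sign_changes N (\<lambda>m. f m \<zeta>) (Suc i)) (nhds \<zeta>)"
        using less.hyps[of "Suc i"] i False by simp
      then show ?thesis
        using eventually_same_sign[OF cont less.prems(2)] eventually_same_sign[OF cont False]
        by eventually_elim (simp add: sign_changes_step[OF i])
    next
      case True
      have op: "f i \<zeta> * f (Suc (Suc i)) \<zeta> < 0" using alt True by blast
      then have ne: "f (Suc (Suc i)) \<zeta> \<noteq> 0" by auto
      have i': "Suc i < N" using i last True by (metis Suc_lessI)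
      \<comment> \<open>Between neighbours of different sign the middle member accounts for exactly
        one change, whatever its own sign.\<close>
      have *: "sign_changes N (\<lambda>m. f m z) i = Suc (sign_changes N (\<lambda>m. f m z) (Suc (Suc i)))"
        if "(f i z > 0) \<noteq> (f (Suc (Suc i)) z > 0)" for z
        using that by (auto simp: sign_changes_step[OF i] sign_changes_step[OF i'])
      have **: "(f i \<zeta> > 0) \<noteq> (f (Suc (Suc i)) \<zeta> > 0)"
        using op by (auto simp: mult_less_0_iff)
      have "eventually (\<lambda>z. sign_changes N (\<lambda>m. f m z) (Suc (Suc i)) =
          sign_changes N (\<lambda>m. f m \<zeta>) (Suc (Suc i))) (nhds \<zeta>)"
        using less.hyps[of "Suc (Suc i)"] i' ne by simp
      then show ?thesis
        using eventually_same_sign[OF cont less.prems(2)] eventually_same_sign[OF cont ne]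
        proof eventually_elim
          case (elim z)
          then show ?case using *[of z] *[of \<zeta>] ** by simp
        qed
    qed
  qed
qed

text \<open>\<open>V\<close> need not be monotone, so for each level \<open>k < n\<close> the last
  place where it is at most \<open>k\<close> is taken, as a supremum \<open>\<zeta> k\<close>. There
  \<open>V\<close> is not locally constant, hence \<open>g\<close> vanishes; the levels give
  distinct points because \<open>V\<close> takes only two consecutive values near a point.\<close>

lemma many_zeros_of_locally_constant:
  fixes V :: "real \<Rightarrow> nat" and g :: "real \<Rightarrow> real"
  assumes pq: "p \<le> q" and Vp: "V p = 0" and Vq: "n \<le> V q" and gq: "g q \<noteq> 0"
    and loc0: "\<And>\<zeta>. p \<le> \<zeta> \<Longrightarrow> \<zeta> \<le> q \<Longrightarrow> g \<zeta> \<noteq> 0 \<Longrightarrow> eventually (\<lambda>z. V z = V \<zeta>) (nhds \<zeta>)"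
    and loc1: "\<And>\<zeta>. p \<le> \<zeta> \<Longrightarrow> \<zeta> \<le> q \<Longrightarrow> \<exists>c. eventually (\<lambda>z. V z = c \<or> V z = Suc c) (nhds \<zeta>)"
  shows "\<exists>Z\<subseteq>{p..q}. finite Z \<and> card Z = n \<and> (\<forall>z\<in>Z. g z = 0)"
proof -
  define A where "A = (\<lambda>k. {z \<in> {p..q}. V z \<le> k})"
  define \<zeta> where "\<zeta> = (\<lambda>k. Sup (A k))"
  have bdd: "bdd_above (A k)" for k by (auto simp: A_def bdd_above_def)
  have mem: "p \<in> A k" for k using pq Vp by (auto simp: A_def)
  have upper: "z \<le> \<zeta> k" if "z \<in> A k" for z k
    unfolding \<zeta>_def using that bdd by (rule cSup_upper)
  have range1: "p \<le> \<zeta> k" for k using upper[OF mem] .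
  have range2: "\<zeta> k \<le> q" for k
    unfolding \<zeta>_def by (rule cSup_least) (use mem[of k] in \<open>auto simp: A_def\<close>)
  have left: "\<exists>z\<in>A k. d < z" if "d < \<zeta> k" for k d
    by (rule less_cSupD) (use mem[of k] that in \<open>auto simp: \<zeta>_def\<close>)
  have right: "V z > k" if "\<zeta> k < z" "z \<le> q" for k z
  proof (rule ccontr)
    assume "\<not> k < V z"
    then have "z \<in> A k" using that range1[of k] by (auto simp: A_def)
    then show False using upper[of z k] that by simp
  qed
  have near: "\<exists>z\<in>A k. P z" if "eventually P (nhds (\<zeta> k))" for P k
  proof -
    obtain d where d: "d > 0" "\<And>z. dist z (\<zeta> k) < d \<Longrightarrow> P z"
      using \<open>eventually P (nhds (\<zeta> k))\<close> unfolding eventually_nhds_metric by blast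
    obtain z where z: "z \<in> A k" "\<zeta> k - d < z" using left[of "\<zeta> k - d" k] d(1) by auto
    then have "dist z (\<zeta> k) < d" using upper[OF z(1)] by (simp add: dist_real_def)
    then show ?thesis using d(2) z(1) by blast
  qed
  have near': "\<exists>z. \<zeta> k < z \<and> z \<le> q \<and> P z" if "eventually P (nhds (\<zeta> k))" "\<zeta> k < q" for P k
  proof -
    obtain d where d: "d > 0" "\<And>z. dist z (\<zeta> k) < d \<Longrightarrow> P z"
      using \<open>eventually P (nhds (\<zeta> k))\<close> unfolding eventually_nhds_metric by blast
    define z where "z = min q (\<zeta> k + d / 2)"
    have "\<zeta> k < z" "z \<le> q" "dist z (\<zeta> k) < d"
      using d(1) that(2) by (auto simp: z_def dist_real_def)
    then show ?thesis using d(2) by blast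
  qed
  \<comment> \<open>Near \<open>q\<close> the count is constant and at least \<open>n > k\<close>,
    whereas \<open>A k\<close> comes arbitrarily close to \<open>\<zeta> k\<close>.\<close>
  have lt: "\<zeta> k < q" if "k < n" for k
  proof (rule ccontr)
    assume "\<not> \<zeta> k < q"
    then have eq: "\<zeta> k = q" using range2[of k] by linarith
    have "eventually (\<lambda>z. V z = V q) (nhds (\<zeta> k))" unfolding eq using loc0 gq pq by blast
    from near[OF this] obtain z where "V z \<le> k" "V z = V q" by (auto simp: A_def)
    then show False using that Vq by linarith
  qed
  have zero: "g (\<zeta> k) = 0" if k: "k < n" for k
  proof (rule ccontr)
    assume "g (\<zeta> k) \<noteq> 0"
    then have ev: "eventually (\<lambda>z. V z = V (\<zeta> k)) (nhds (\<zeta> k))" using loc0[OF range1 range2] by blast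
    obtain z where "V z \<le> k" "V z = V (\<zeta> k)" using near[OF ev] by (auto simp: A_def)
    moreover obtain z' where "\<zeta> k < z'" "z' \<le> q" "V z' = V (\<zeta> k)"
      using near'[OF ev lt[OF k]] by blast
    ultimately show False using right[of k z'] by linarith
  qed
  \<comment> \<open>At a common supremum, counts of at most \<open>k\<close> and counts of at least
    \<open>l + 1 \<ge> k + 2\<close> would occur arbitrarily near.\<close>
  have ne: "\<zeta> k \<noteq> \<zeta> l" if kl: "k < l" "l < n" for k l
  proof
    assume eq: "\<zeta> k = \<zeta> l"
    obtain c where ev: "eventually (\<lambda>z. V z = c \<or> V z = Suc c) (nhds (\<zeta> k))"
      using loc1[OF range1 range2] by blast
    obtain z where "V z \<le> k" "V z = c \<or> V z = Suc c" using near[OF ev] by (auto simp: A_def)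
    moreover obtain z' where "\<zeta> l < z'" "z' \<le> q" "V z' = c \<or> V z' = Suc c"
      using near'[OF ev[unfolded eq] lt[OF kl(2)]] by blast
    ultimately show False using right[of l z'] kl by linarith
  qed
  have "inj_on \<zeta> {..<n}"
    by (rule linorder_inj_onI) (use ne in blast, use linear in blast)
  then show ?thesis
    by (intro exI[of _ "\<zeta> ` {..<n}"]) (auto simp: card_image zero intro!: range1 range2)
qed

text \<open>Interior zeros leave the count unchanged, so it can change only at zeros of
  \<open>f 0\<close>. There \<open>f 1\<close> is nonzero, and only the pair of indices 0 and 1 is
  undecided, contributing 0 or 1.\<close>

lemma sturm_chain_zeros:
  fixes f :: "nat \<Rightarrow> real \<Rightarrow> real"
  assumes pq: "p \<le> q" and cont: "\<And>m \<zeta>. isCont (f m) \<zeta>"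
    and alt: "\<And>m \<zeta>. p \<le> \<zeta> \<Longrightarrow> \<zeta> \<le> q \<Longrightarrow> f (Suc m) \<zeta> = 0 \<Longrightarrow> f m \<zeta> * f (Suc (Suc m)) \<zeta> < 0"
    and last: "\<And>\<zeta>. p \<le> \<zeta> \<Longrightarrow> \<zeta> \<le> q \<Longrightarrow> f N \<zeta> \<noteq> 0" and N: "N > 0"
    and p: "sign_changes N (\<lambda>m. f m p) 0 = 0" and q: "n \<le> sign_changes N (\<lambda>m. f m q) 0"
    and q0: "f 0 q \<noteq> 0"
  shows "\<exists>Z\<subseteq>{p..q}. finite Z \<and> card Z = n \<and> (\<forall>z\<in>Z. f 0 z = 0)"
proof (rule many_zeros_of_locally_constant[of p q "\<lambda>z. sign_changes N (\<lambda>m. f m z) 0" n "f 0"])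
  have const: "eventually (\<lambda>z. sign_changes N (\<lambda>m. f m z) i = sign_changes N (\<lambda>m. f m \<zeta>) i) (nhds \<zeta>)"
    if "p \<le> \<zeta>" "\<zeta> \<le> q" "i \<le> N" "f i \<zeta> \<noteq> 0" for i \<zeta>
    using that by (intro sign_changes_locally_constant cont alt last)
  show "eventually (\<lambda>z. sign_changes N (\<lambda>m. f m z) 0 = sign_changes N (\<lambda>m. f m \<zeta>) 0) (nhds \<zeta>)"
    if "p \<le> \<zeta>" "\<zeta> \<le> q" "f 0 \<zeta> \<noteq> 0" for \<zeta>
    using const[OF that(1,2) _ that(3)] by simp
  show "\<exists>c. eventually (\<lambda>z. sign_changes N (\<lambda>m. f m z) 0 = c \<or>
      sign_changes N (\<lambda>m. f m z) 0 = Suc c) (nhds \<zeta>)"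
    if \<zeta>: "p \<le> \<zeta>" "\<zeta> \<le> q" for \<zeta>
  proof (cases "f 0 \<zeta> = 0")
    case False
    from const[OF \<zeta> _ this] show ?thesis
      by (intro exI[of _ "sign_changes N (\<lambda>m. f m \<zeta>) 0"]) (auto elim: eventually_mono)
  next
    case True
    have "f 1 \<zeta> \<noteq> 0" using alt[OF \<zeta>, of 0] True by auto
    from const[OF \<zeta> _ this] N have
      "eventually (\<lambda>z. sign_changes N (\<lambda>m. f m z) 1 = sign_changes N (\<lambda>m. f m \<zeta>) 1) (nhds \<zeta>)"
      by simp
    then show ?thesis
      by (intro exI[of _ "sign_changes N (\<lambda>m. f m \<zeta>) 1"], elim eventually_mono)
        (use N in \<open>simp add: sign_changes_step[of 0]\<close>)
  qed
qed (fact pq p q q0)+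

section \<open>The decaying solution\<close>

fun tail_term :: "(nat \<Rightarrow> real) \<Rightarrow> nat \<Rightarrow> nat \<Rightarrow> real \<Rightarrow> real" where
  "tail_term b 0 m z = 0"
| "tail_term b (Suc 0) m z = - z * b (Suc m)"
| "tail_term b (Suc (Suc k)) m z =
    tail_term b (Suc k) (Suc m) z - z * b (Suc m) * tail_term b k (Suc (Suc m)) z"

text \<open>\<open>tail_fun b m z\<close> is, up to normalisation, the limit of the characteristic polynomials of the
  finite sections of the Jacobi matrix with first \<open>m\<close> rows and columns deleted, where
  \<open>b j = (a j)\<^sup>2\<close> and \<open>z = 1 / \<mu>\<^sup>2\<close>; \<open>tail_term\<close> collects the increments as the sections grow.\<close>

definition tail_fun :: "(nat \<Rightarrow> real) \<Rightarrow> nat \<Rightarrow> real \<Rightarrow> real" where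
  "tail_fun b m z = 1 + (\<Sum>k. tail_term b k m z)"

text \<open>Both terms of the recursion have the same value of \<open>m + k\<close>, so the factor
  \<open>b (m + k)\<close> is carried along and makes the bound summable in \<open>k\<close>. Each
  step costs a factor \<open>1 + \<bar>z\<bar> * b (Suc m)\<close>, absorbed by the
  exponential.\<close>

lemma tail_term_bound:
  assumes "\<And>j. b j \<ge> 0"
  shows "\<bar>tail_term b k m z\<bar> \<le> \<bar>z\<bar> * b (m + k) * exp (\<bar>z\<bar> * (\<Sum>i<k. b (Suc m + i)))"
  using assms
proof (induction b k m z rule: tail_term.induct)
  case (1 b m z)
  then show ?case by simp
next
  case (2 b m z)
  have "1 * (\<bar>z\<bar> * b (Suc m)) \<le> exp (\<bar>z\<bar> * b (Suc m)) * (\<bar>z\<bar> * b (Suc m))"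
    using 2 by (intro mult_right_mono) auto
  then show ?case using 2 by (simp add: abs_mult mult_ac)
next
  case (3 b k m z)
  define E where "E = exp (\<bar>z\<bar> * (\<Sum>i<Suc k. b (Suc (Suc m) + i)))"
  define c where "c = \<bar>z\<bar> * b (m + Suc (Suc k))"
  have c: "c \<ge> 0" using "3.prems" by (simp add: c_def)
  have 1: "\<bar>tail_term b (Suc k) (Suc m) z\<bar> \<le> c * E"
    using "3.IH"(1)[OF "3.prems"] by (simp add: c_def E_def)
  have "\<bar>tail_term b k (Suc (Suc m)) z\<bar> \<le>
      c * exp (\<bar>z\<bar> * (\<Sum>i<k. b (Suc (Suc (Suc m)) + i)))"
    using "3.IH"(2)[OF "3.prems"] by (simp add: c_def)
  also have "\<dots> \<le> c * E"
    unfolding E_def using "3.prems" c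
    by (subst sum.lessThan_Suc_shift) (auto intro!: mult_left_mono)
  finally have 2: "\<bar>tail_term b k (Suc (Suc m)) z\<bar> \<le> c * E" .
  have "\<bar>tail_term b (Suc (Suc k)) m z\<bar> \<le>
      \<bar>tail_term b (Suc k) (Suc m) z\<bar> + \<bar>z * b (Suc m) * tail_term b k (Suc (Suc m)) z\<bar>"
    by (simp only: tail_term.simps abs_triangle_ineq4)
  also have "\<bar>z * b (Suc m) * tail_term b k (Suc (Suc m)) z\<bar> \<le> \<bar>z\<bar> * b (Suc m) * (c * E)"
    using 2 "3.prems" by (auto simp: abs_mult intro!: mult_mono)
  also have "\<bar>tail_term b (Suc k) (Suc m) z\<bar> + \<bar>z\<bar> * b (Suc m) * (c * E) \<le>
      c * E * (1 + \<bar>z\<bar> * b (Suc m))"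
    using 1 by (simp add: algebra_simps)
  also have "\<dots> \<le> c * E * exp (\<bar>z\<bar> * b (Suc m))"
    using c by (intro mult_left_mono exp_ge_add_one_self) (simp add: E_def)
  also have "\<dots> = c * exp (\<bar>z\<bar> * (\<Sum>i<Suc (Suc k). b (Suc m + i)))"
    unfolding E_def
    by (subst (2) sum.lessThan_Suc_shift) (simp add: exp_add[symmetric] algebra_simps)
  finally show ?case by (simp add: c_def)
qed

lemma summable_shift_left:
  fixes b :: "nat \<Rightarrow> real"
  assumes "summable b"
  shows "summable (\<lambda>i. b (m + i))"
  using summable_iff_shift[of b m] assms by (simp add: add.commute)

lemma tail_sum_tendsto_0:
  fixes b :: "nat \<Rightarrow> real"
  assumes "summable b"
  shows "(\<lambda>m. \<Sum>i. b (Suc m + i)) \<longlonglongrightarrow> 0"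
  using LIMSEQ_Suc[OF suminf_exist_split2[OF assms]] by (simp add: add.commute)

text \<open>The full tail in the exponent makes the constant independent of \<open>k\<close>; this
  is the majorant for all convergence arguments below.\<close>

lemma tail_term_bound_tail:
  assumes b: "\<And>j. b j \<ge> 0" and sb: "summable b"
  shows "\<bar>tail_term b (Suc k) m z\<bar> \<le>
    \<bar>z\<bar> * exp (\<bar>z\<bar> * (\<Sum>i. b (Suc m + i))) * b (Suc m + k)"
proof -
  have "(\<Sum>i<Suc k. b (Suc m + i)) \<le> (\<Sum>i. b (Suc m + i))"
    by (intro sum_le_suminf summable_shift_left sb) (auto simp: b)
  then have "\<bar>z\<bar> * b (Suc m + k) * exp (\<bar>z\<bar> * (\<Sum>i<Suc k. b (Suc m + i))) \<le>
      \<bar>z\<bar> * b (Suc m + k) * exp (\<bar>z\<bar> * (\<Sum>i. b (Suc m + i)))"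
    using b by (intro mult_left_mono) (auto intro: mult_left_mono)
  then show ?thesis using tail_term_bound[of b "Suc k" m z] b by (simp add: mult_ac)
qed

lemma summable_tail_term:
  assumes b: "\<And>j. b j \<ge> 0" and sb: "summable b"
  shows "summable (\<lambda>k. tail_term b k m z)"
proof -
  have "summable (\<lambda>k. tail_term b (Suc k) m z)"
    by (rule summable_comparison_test'[of
          "\<lambda>k. \<bar>z\<bar> * exp (\<bar>z\<bar> * (\<Sum>i. b (Suc m + i))) * b (Suc m + k)" 0])
      (use tail_term_bound_tail[OF b sb] in \<open>auto intro!: summable_mult summable_shift_left[OF sb, of "Suc m", simplified]\<close>)
  then show ?thesis using summable_Suc_iff[of "\<lambda>k. tail_term b k m z"] by blast
qed

lemma tail_fun_Suc_series:
  assumes b: "\<And>j. b j \<ge> 0" and sb: "summable b"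
  shows "tail_fun b m z = 1 + (\<Sum>k. tail_term b (Suc k) m z)"
  unfolding tail_fun_def using suminf_split_head[OF summable_tail_term[OF b sb]] by simp

text \<open>Sum of the recursion for \<open>tail_term\<close>; the head term
  \<open>- z * b (Suc m)\<close> accounts for the summand 1 in \<open>tail_fun\<close> at
  \<open>Suc (Suc m)\<close>.\<close>

lemma tail_fun_rec:
  assumes b: "\<And>j. b j \<ge> 0" and sb: "summable b"
  shows "tail_fun b m z = tail_fun b (Suc m) z - z * b (Suc m) * tail_fun b (Suc (Suc m)) z"
proof -
  note S = summable_tail_term[OF b sb]
  have S': "summable (\<lambda>k. tail_term b (Suc k) m z)" for m
    using S summable_Suc_iff[of "\<lambda>k. tail_term b k m z"] by blast
  have "tail_fun b m z = 1 + (- z * b (Suc m) + (\<Sum>k. tail_term b (Suc (Suc k)) m z))"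
    unfolding tail_fun_Suc_series[OF b sb] using suminf_split_head[OF S', of m] by simp
  also have "(\<Sum>k. tail_term b (Suc (Suc k)) m z) = (\<Sum>k. tail_term b (Suc k) (Suc m) z)
      - z * b (Suc m) * (\<Sum>k. tail_term b k (Suc (Suc m)) z)"
    unfolding tail_term.simps
    by (subst suminf_diff[symmetric]) (auto intro!: S' S summable_mult simp: suminf_mult S)
  finally show ?thesis
    unfolding tail_fun_Suc_series[OF b sb, of "Suc m"]
    by (simp add: tail_fun_def algebra_simps)
qed

text \<open>Sum of the majorant. It is small whenever \<open>z\<close> times the tail of
  \<open>b\<close> is: at \<open>z = 0\<close>, for fixed \<open>z\<close> and large
  \<open>m\<close>, and for \<open>z\<close> of order at most \<open>1 / b m\<close> when
  \<open>b\<close> decays fast.\<close>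

lemma tail_fun_near_1:
  assumes b: "\<And>j. b j \<ge> 0" and sb: "summable b"
  shows "\<bar>tail_fun b m z - 1\<bar> \<le>
    \<bar>z\<bar> * (\<Sum>i. b (Suc m + i)) * exp (\<bar>z\<bar> * (\<Sum>i. b (Suc m + i)))"
proof -
  let ?C = "\<bar>z\<bar> * exp (\<bar>z\<bar> * (\<Sum>i. b (Suc m + i)))"
  have s: "summable (\<lambda>k. b (Suc m + k))" by (rule summable_shift_left[OF sb])
  have "norm (\<Sum>k. tail_term b (Suc k) m z) \<le> (\<Sum>k. ?C * b (Suc m + k))"
    using tail_term_bound_tail[OF b sb] by (intro norm_suminf_le summable_mult s) auto
  also have "\<dots> = ?C * (\<Sum>k. b (Suc m + k))" by (rule suminf_mult[OF s])
  finally show ?thesis by (simp add: tail_fun_Suc_series[OF b sb] mult_ac)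
qed

lemma tail_fun_0:
  assumes b: "\<And>j. b j \<ge> 0" and sb: "summable b"
  shows "tail_fun b m 0 = 1"
  using tail_fun_near_1[OF b sb, of m 0] by simp

text \<open>The terms are polynomials in \<open>z\<close>, and the series converges uniformly on a
  ball around 0 containing \<open>z\<close>, by the Weierstrass test.\<close>

lemma isCont_tail_fun:
  assumes b: "\<And>j. b j \<ge> 0" and sb: "summable b"
  shows "isCont (tail_fun b m) z"
proof -
  have cont: "continuous_on A (tail_term b k m)" for A k m
  proof (induction k arbitrary: m rule: less_induct)
    case (less k)
    consider "k = 0" | "k = Suc 0" | j where "k = Suc (Suc j)" by (metis not0_implies_Suc)
    then show ?case
    proof cases
      case 3
      then show ?thesis
        using less[of "Suc j" "Suc m"] less[of j "Suc (Suc m)"]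
        by (auto intro!: continuous_intros)
    qed (auto intro!: continuous_intros)
  qed
  define R where "R = \<bar>z\<bar> + 1"
  let ?T = "\<Sum>i. b (Suc m + i)"
  have T: "?T \<ge> 0" by (intro suminf_nonneg summable_shift_left sb b)
  have "uniform_limit (ball 0 R) (\<lambda>n x. \<Sum>k<n. tail_term b (Suc k) m x)
      (\<lambda>x. \<Sum>k. tail_term b (Suc k) m x) sequentially"
  proof (rule Weierstrass_m_test)
    show "norm (tail_term b (Suc k) m x) \<le> R * exp (R * ?T) * b (Suc m + k)"
      if "x \<in> ball 0 R" for k x
    proof -
      have x: "\<bar>x\<bar> \<le> R" using that by simp
      have "\<bar>x\<bar> * exp (\<bar>x\<bar> * ?T) \<le> R * exp (R * ?T)"
        using x T by (intro mult_mono) (auto intro: mult_right_mono)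
      then have "\<bar>x\<bar> * exp (\<bar>x\<bar> * ?T) * b (Suc m + k) \<le> R * exp (R * ?T) * b (Suc m + k)"
        using b by (intro mult_right_mono)
      then show ?thesis using tail_term_bound_tail[OF b sb, of k m x] by simp
    qed
    show "summable (\<lambda>k. R * exp (R * ?T) * b (Suc m + k))"
      by (intro summable_mult summable_shift_left sb)
  qed
  then have "continuous_on (ball 0 R) (\<lambda>x. \<Sum>k. tail_term b (Suc k) m x)"
    by (rule uniform_limit_theorem[rotated])
      (auto simp del: tail_term.simps intro!: always_eventually continuous_on_sum cont)
  then have "continuous_on (ball 0 R) (tail_fun b m)"
    unfolding tail_fun_Suc_series[OF b sb, abs_def] by (intro continuous_intros)
  moreover have "z \<in> ball 0 R" by (simp add: R_def)
  ultimately show ?thesis by (simp add: continuous_on_eq_continuous_at)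
qed

lemma tail_fun_tendsto_1:
  assumes b: "\<And>j. b j \<ge> 0" and sb: "summable b"
  shows "(\<lambda>m. tail_fun b m z) \<longlonglongrightarrow> 1"
proof -
  define T where "T = (\<lambda>m. \<Sum>i. b (Suc m + i))"
  have T: "T \<longlonglongrightarrow> 0"
    unfolding T_def by (rule tail_sum_tendsto_0[OF sb])
  have "(\<lambda>m. \<bar>z\<bar> * T m * exp (\<bar>z\<bar> * T m)) \<longlonglongrightarrow> \<bar>z\<bar> * 0 * exp (\<bar>z\<bar> * 0)"
    by (intro tendsto_mult tendsto_exp tendsto_const T)
  then have lim: "(\<lambda>m. \<bar>z\<bar> * T m * exp (\<bar>z\<bar> * T m)) \<longlonglongrightarrow> 0" by simp
  have "norm (tail_fun b m z - 1) \<le> \<bar>z\<bar> * T m * exp (\<bar>z\<bar> * T m)" for m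
    unfolding T_def real_norm_def by (rule tail_fun_near_1[OF b sb])
  then have "(\<lambda>m. tail_fun b m z - 1) \<longlonglongrightarrow> 0"
    by (intro Lim_null_comparison[OF always_eventually lim]) blast
  then show ?thesis by (simp only: LIM_zero_iff)
qed

section \<open>From zeros of the decaying solution to eigenvectors\<close>

lemma summable_if_ratio_tendsto_0:
  fixes b :: "nat \<Rightarrow> real"
  assumes pos: "\<And>n. n \<ge> 1 \<Longrightarrow> b n > 0" and ratio: "(\<lambda>n. b (Suc n) / b n) \<longlonglongrightarrow> 0"
  shows "summable b"
proof -
  have "eventually (\<lambda>n. b (Suc n) / b n < 1 / 2) sequentially"
    using order_tendstoD(2)[OF ratio, of "1 / 2"] by simp
  then obtain N where N: "\<And>n. n \<ge> N \<Longrightarrow> b (Suc n) / b n < 1 / 2"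
    by (auto simp: eventually_sequentially)
  have "norm (b (Suc n)) \<le> 1 / 2 * norm (b n)" if "n \<ge> max N 1" for n
    using N[of n] pos[of n] pos[of "Suc n"] that by (simp add: field_simps)
  then show ?thesis by (intro summable_ratio_test[of "1 / 2" "max N 1"]) auto
qed

text \<open>With \<open>s = 1 / \<mu>\<close>, the prefactor \<open>P n\<close>, a product of
  \<open>a j * s\<close>, turns the recurrence of \<open>F\<close> into the eigenvalue equation. As
  \<open>a\<close> tends to 0, \<open>P\<close> is square summable, and \<open>F\<close> is bounded;
  \<open>F\<close> tending to 1 makes the vector nonzero.\<close>

lemma eigenvalue_of_tail_fun_zero:
  assumes pos: "\<And>n. n \<ge> 1 \<Longrightarrow> a n > 0" and a: "a \<longlonglongrightarrow> 0" and sa: "summable (\<lambda>j. (a j)\<^sup>2)"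
    and z: "z > 0" and zero: "tail_fun (\<lambda>j. (a j)\<^sup>2) 0 z = 0"
  shows "1 / sqrt z \<in> positive_eigenvalues (jacobi_op a)"
proof -
  define s where "s = sqrt z"
  have s: "s > 0" "s\<^sup>2 = z" using z by (auto simp: s_def)
  define F where "F = (\<lambda>m. tail_fun (\<lambda>j. (a j)\<^sup>2) m z)"
  have rec: "F m = F (Suc m) - s\<^sup>2 * (a (Suc m))\<^sup>2 * F (Suc (Suc m))" for m
    unfolding F_def s(2) by (rule tail_fun_rec) (auto simp: sa)
  have F1: "F \<longlonglongrightarrow> 1" unfolding F_def by (rule tail_fun_tendsto_1) (auto simp: sa)
  define P where "P = (\<lambda>n. \<Prod>j\<in>{1..<n}. a j * s)"
  have P_Suc: "P (Suc n) = P n * (a n * s)" if "n \<ge> 1" for n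
    using that by (simp add: P_def prod.atLeastLessThan_Suc)
  have P_pos: "P n > 0" for n unfolding P_def by (intro prod_pos) (use pos s in auto)
  define x where "x = (\<lambda>n. if n = 0 then 0 else P n * F n)"
  have eq: "a n * x n + a (Suc n) * x (Suc (Suc n)) = 1 / s * x (Suc n)" for n
  proof (cases "n = 0")
    case True
    \<comment> \<open>The zero of \<open>F 0\<close> is exactly the first row of the eigenvalue
      equation.\<close>
    have "F 1 = s\<^sup>2 * (a 1)\<^sup>2 * F 2"
      using rec[of 0] zero by (simp add: F_def numeral_2_eq_2)
    then show ?thesis
      using True s P_Suc[of 1] by (simp add: x_def P_def field_simps power2_eq_square numeral_2_eq_2)
  next
    case False
    have "s * (a n * x n + a (Suc n) * x (Suc (Suc n))) =
        P n * (a n * s) * (F n + s\<^sup>2 * (a (Suc n))\<^sup>2 * F (Suc (Suc n)))"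
      using False P_Suc[of n] P_Suc[of "Suc n"] by (simp add: x_def power2_eq_square algebra_simps)
    also have "\<dots> = x (Suc n)"
      using rec[of n] False P_Suc[of n] by (simp add: x_def)
    finally show ?thesis using s by (simp add: field_simps)
  qed
  have "summable (\<lambda>n. (P n)\<^sup>2)"
  proof -
    have "(\<lambda>n. a n * s) \<longlonglongrightarrow> 0 * s" by (intro tendsto_intros a)
    then have "eventually (\<lambda>n. a n * s < 1 / 2) sequentially"
      by (intro order_tendstoD(2)[of _ "0 * s"]) auto
    then obtain N where N: "\<And>n. n \<ge> N \<Longrightarrow> a n * s < 1 / 2"
      by (auto simp: eventually_sequentially)
    have "norm ((P (Suc n))\<^sup>2) \<le> 1 / 4 * norm ((P n)\<^sup>2)" if n: "n \<ge> max N 1" for n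
    proof -
      have "(a n * s)\<^sup>2 \<le> (1 / 2)\<^sup>2"
        using N[of n] pos[of n] s n by (intro power_mono) (auto intro: less_imp_le)
      then have "(P n)\<^sup>2 * (a n * s)\<^sup>2 \<le> (P n)\<^sup>2 * (1 / 2)\<^sup>2"
        by (rule mult_left_mono) simp
      moreover have "(P (Suc n))\<^sup>2 = (P n)\<^sup>2 * (a n * s)\<^sup>2"
        using P_Suc[of n] n by (simp add: power_mult_distrib)
      ultimately show ?thesis by (simp add: power2_eq_square)
    qed
    then show ?thesis by (intro summable_ratio_test[of "1 / 4" "max N 1"]) auto
  qed
  then have sum: "summable (\<lambda>n. B\<^sup>2 * (P n)\<^sup>2)" for B by (rule summable_mult)
  have "Bseq F" using F1 by (intro convergent_imp_Bseq convergentI)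
  then obtain B where B: "\<And>n. norm (F n) \<le> B" by (rule BseqE) blast
  have "summable (\<lambda>n. (cmod (complex_of_real (x n)))\<^sup>2)"
  proof (rule summable_comparison_test'[of "\<lambda>n. B\<^sup>2 * (P n)\<^sup>2" 0])
    show "norm ((cmod (complex_of_real (x n)))\<^sup>2) \<le> B\<^sup>2 * (P n)\<^sup>2" for n
    proof -
      have "(F n)\<^sup>2 \<le> B\<^sup>2" using power_mono[OF B[of n], of 2] by simp
      then have "(P n)\<^sup>2 * (F n)\<^sup>2 \<le> (P n)\<^sup>2 * B\<^sup>2" by (rule mult_left_mono) simp
      then show ?thesis by (simp add: x_def power_mult_distrib mult.commute)
    qed
  qed (rule sum)
  then have ell2: "(\<lambda>n. complex_of_real (x n)) \<in> ell2" by (simp add: ell2_def x_def)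
  have "eventually (\<lambda>n. F n > 0) sequentially" using order_tendstoD(1)[OF F1] by simp
  then obtain N where "\<And>n. n \<ge> N \<Longrightarrow> F n > 0" by (auto simp: eventually_sequentially)
  then have "F (Suc N) \<noteq> 0" by (metis le_SucI less_irrefl order_refl)
  then have "x (Suc N) \<noteq> 0" using P_pos[of "Suc N"] by (simp add: x_def)
  then have ne: "(\<lambda>n. complex_of_real (x n)) \<noteq> (\<lambda>n. 0)" by (auto dest: fun_cong[of _ _ "Suc N"])
  have eq': "complex_of_real (a n) * x n + a (Suc n) * x (Suc (Suc n)) = (1 / s) * x (Suc n)" for n
    unfolding of_real_mult[symmetric] of_real_add[symmetric] eq by simp
  show ?thesis
    unfolding positive_eigenvalues_jacobi_op_iff s_def[symmetric]
    using s(1) ell2 ne eq' by (intro conjI bexI[of _ "\<lambda>n. complex_of_real (x n)"] allI) simp_all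
qed

section \<open>Sign pattern and eigenvalue count\<close>

text \<open>With \<open>r = - f2 / f3\<close> the two steps compose to \<open>- f0 / f1 = z A r / (r + z B) - 1\<close>, which is
  increasing in \<open>r\<close>.\<close>

lemma sturm_ratio_step:
  fixes f0 f1 f2 f3 :: real
  assumes f0: "f0 = f1 - z * A * f2" and f1: "f1 = f2 - z * B * f3"
    and "z > 0" "A > 0" "B > 0" "r0 > 0" and f3: "f3 \<noteq> 0" and r: "r0 \<le> - f2 / f3"
  shows "f1 \<noteq> 0 \<and> z * A * r0 / (r0 + z * B) - 1 \<le> - f0 / f1"
proof -
  define r where "r = - f2 / f3"
  have r: "r0 \<le> r" "f2 = - r * f3" using r f3 by (auto simp: r_def)
  have zB: "z * B > 0" and zA: "z * A > 0" using assms by auto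
  have f1': "f1 = - (r + z * B) * f3" using f1 r by (simp add: algebra_simps)
  have "r + z * B > 0" using r(1) zB \<open>r0 > 0\<close> by linarith
  then have ne: "f1 \<noteq> 0" using f1' f3 by simp
  have "f0 = f1 + z * A * r * f3" using f0 r by simp
  then have "- f0 / f1 = - 1 - z * A * r * f3 / f1" using ne by (simp add: field_simps)
  also have "z * A * r * f3 / f1 = - (z * A * r / (r + z * B))"
    unfolding f1' using f3 \<open>r + z * B > 0\<close> by (simp add: divide_simps) (simp add: algebra_simps)
  finally have "- f0 / f1 = z * A * (r / (r + z * B)) - 1" by simp
  moreover have "r0 / (r0 + z * B) \<le> r / (r + z * B)"
    using r(1) zB \<open>r0 > 0\<close> \<open>r + z * B > 0\<close> mult_right_mono[of r0 r "z * B"]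
    by (simp add: divide_le_eq pos_le_divide_eq algebra_simps)
  then have "z * A * (r0 / (r0 + z * B)) \<le> z * A * (r / (r + z * B))"
    using zA by (intro mult_left_mono) auto
  ultimately show ?thesis using ne by simp
qed

text \<open>The ratio \<open>r p j\<close> of minus member \<open>2 * j\<close> to member
  \<open>2 * j + 1\<close> must be positive for all \<open>j \<le> p\<close>. It is at least
  \<open>\<epsilon> / 2\<close> at \<open>j = p\<close>, its lower bound doubles with each step down
  to a fixed \<open>M\<close>, and for each fixed \<open>j < M\<close> it tends to infinity with
  \<open>p\<close>.\<close>

lemma tail_fun_alternates:
  fixes b :: "nat \<Rightarrow> real"
  assumes pos: "\<And>n. n \<ge> 1 \<Longrightarrow> b n > 0" and b0: "b 0 \<ge> 0"
    and ratio: "(\<lambda>n. b (Suc n) / b n) \<longlonglongrightarrow> 0"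
    and \<epsilon>: "0 < \<epsilon>" "\<epsilon> \<le> 1 / 2"
  defines "Z \<equiv> \<lambda>p. 1 / ((1 - \<epsilon>)\<^sup>2 * b (Suc (2 * p)))"
  shows "eventually (\<lambda>p. \<forall>j\<le>p.
    tail_fun b (2 * j) (Z p) * tail_fun b (Suc (2 * j)) (Z p) < 0) sequentially"
proof -
  have nn: "b j \<ge> 0" for j using pos[of j] b0 by (cases "j = 0") auto
  have sb: "summable b" by (rule summable_if_ratio_tendsto_0[OF pos ratio])
  have rec: "tail_fun b m z = tail_fun b (Suc m) z - z * b (Suc m) * tail_fun b (Suc (Suc m)) z" for m z
    by (rule tail_fun_rec[OF nn sb])
  \<comment> \<open>The value 96 serves two estimates:
    \<open>2 * \<theta> * 4 = \<epsilon> / 12\<close> at \<open>j = p\<close>, and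
    \<open>96 * B \<le> \<epsilon> * A\<close> in the doubling step.\<close>
  define \<theta> where "\<theta> = \<epsilon> / 96"
  have \<theta>: "0 < \<theta>" "\<theta> \<le> 1 / 96" using \<epsilon> by (auto simp: \<theta>_def)
  have "eventually (\<lambda>n. b (Suc n) / b n < \<theta>) sequentially"
    using order_tendstoD(2)[OF ratio] \<theta> by simp
  then obtain M0 where M0: "\<And>n. n \<ge> M0 \<Longrightarrow> b (Suc n) / b n < \<theta>"
    by (auto simp: eventually_sequentially)
  define M where "M = max M0 1"
  have dec: "b (Suc m) \<le> \<theta> * b m" if "m \<ge> M" for m
    using M0[of m] pos[of m] that by (simp add: M_def field_simps)
  have tail: "(\<Sum>i. b (Suc m + i)) \<le> 2 * \<theta> * b m" if m: "m \<ge> M" for m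
  proof -
    have le: "b (Suc m + i) \<le> \<theta> * b m * \<theta> ^ i" for i
    proof (induction i)
      case (Suc i)
      have "b (Suc m + Suc i) \<le> \<theta> * b (Suc m + i)" using dec[of "Suc m + i"] m by simp
      also have "\<dots> \<le> \<theta> * (\<theta> * b m * \<theta> ^ i)" using Suc \<theta> by (intro mult_left_mono) auto
      finally show ?case by (simp add: mult_ac)
    qed (use dec[OF m] in simp)
    have "(\<Sum>i. b (Suc m + i)) \<le> (\<Sum>i. \<theta> * b m * \<theta> ^ i)"
      by (intro suminf_le le summable_shift_left sb summable_mult summable_geometric) (use \<theta> in auto)
    also have "\<dots> = \<theta> * b m / (1 - \<theta>)"
      using \<theta> by (subst suminf_mult) (auto simp: suminf_geometric)
    also have "\<dots> \<le> \<theta> * b m / (1 / 2)"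
      using \<theta> nn by (intro divide_left_mono) auto
    finally show ?thesis by simp
  qed
  define f where "f = (\<lambda>p m. tail_fun b m (Z p))"
  define r where "r = (\<lambda>p j. - f p (2 * j) / f p (Suc (2 * j)))"
  have Zpos: "Z p > 0" for p using pos[of "Suc (2 * p)"] \<epsilon> by (simp add: Z_def)
  have Zb: "Z p * b (Suc (2 * p)) = 1 / (1 - \<epsilon>)\<^sup>2" for p
    using pos[of "Suc (2 * p)"] by (simp add: Z_def)
  have q_le: "1 / (1 - \<epsilon>)\<^sup>2 \<le> 4"
  proof -
    have "(1 / 2)\<^sup>2 \<le> (1 - \<epsilon>)\<^sup>2" using \<epsilon> by (intro power_mono) auto
    then show ?thesis using \<epsilon> by (simp add: divide_simps power2_eq_square)
  qed
  \<comment> \<open>This margin over 1, due to the factor \<open>1 - \<epsilon>\<close> in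
    \<open>\<mu>\<close>, is what makes \<open>f p (2 * p)\<close> negative.\<close>
  have q_ge: "1 / (1 - \<epsilon>)\<^sup>2 \<ge> 1 + 2 * \<epsilon>"
  proof -
    have "(1 + 2 * \<epsilon>) * (1 - \<epsilon>)\<^sup>2 = 1 - \<epsilon>\<^sup>2 * (3 - 2 * \<epsilon>)" by (simp add: power2_eq_square algebra_simps)
    also have "\<dots> \<le> 1" using \<epsilon> by simp
    finally show ?thesis using \<epsilon> by (simp add: divide_simps)
  qed
  have step_fact: "f p (Suc (2 * j)) \<noteq> 0 \<and>
      Z p * b (Suc (2 * j)) * r0 / (r0 + Z p * b (2 * Suc j)) - 1 \<le> r p j"
    if "f p (Suc (2 * Suc j)) \<noteq> 0" "r0 \<le> r p (Suc j)" "r0 > 0" for p j r0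
    unfolding r_def
  proof (rule sturm_ratio_step)
    show "f p (2 * j) = f p (Suc (2 * j)) - Z p * b (Suc (2 * j)) * f p (2 * Suc j)"
      using rec[of "2 * j" "Z p"] by (simp add: f_def)
    show "f p (Suc (2 * j)) = f p (2 * Suc j) - Z p * b (2 * Suc j) * f p (Suc (2 * Suc j))"
      using rec[of "Suc (2 * j)" "Z p"] by (simp add: f_def)
  qed (use that Zpos pos in \<open>auto simp: r_def\<close>)
  \<comment> \<open>Members \<open>2 * p + 1\<close> and \<open>2 * p + 2\<close> are within
    \<open>\<epsilon> / 4\<close> of 1, so the recurrence makes member \<open>2 * p\<close> at most
    \<open>- \<epsilon>\<close>, while member \<open>2 * p + 1\<close> is at most 2.\<close>
  have base_fact: "f p (Suc (2 * p)) \<noteq> 0 \<and> \<epsilon> / 2 \<le> r p p" if p: "p \<ge> M" for p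
  proof -
    have near: "\<bar>f p m - 1\<bar> \<le> \<epsilon> / 4" if m: "Suc (2 * p) \<le> m" "m \<le> Suc (Suc (2 * p))" for m
    proof -
      define T where "T = (\<Sum>i. b (Suc m + i))"
      have T0: "T \<ge> 0" unfolding T_def by (intro suminf_nonneg summable_shift_left sb nn)
      have "b m \<le> b (Suc (2 * p))"
      proof (cases "m = Suc (2 * p)")
        case False
        then have "m = Suc (Suc (2 * p))" using m by simp
        then have "b m \<le> \<theta> * b (Suc (2 * p))" using dec[of "Suc (2 * p)"] p by simp
        also have "\<dots> \<le> 1 * b (Suc (2 * p))" using \<theta> nn by (intro mult_right_mono) auto
        finally show ?thesis by simp
      qed simp
      then have "2 * \<theta> * b m \<le> 2 * \<theta> * b (Suc (2 * p))"
        using \<theta> by (intro mult_left_mono) auto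
      moreover have "T \<le> 2 * \<theta> * b m" using tail[of m] m p by (simp add: T_def)
      ultimately have "T \<le> 2 * \<theta> * b (Suc (2 * p))" by linarith
      then have "Z p * T \<le> Z p * (2 * \<theta> * b (Suc (2 * p)))"
        using Zpos[of p] by (intro mult_left_mono) auto
      also have "\<dots> = 2 * \<theta> * (Z p * b (Suc (2 * p)))" by simp
      also have "\<dots> \<le> 2 * \<theta> * 4" unfolding Zb using q_le \<theta> by (intro mult_left_mono) auto
      finally have ZT: "Z p * T \<le> \<epsilon> / 12" by (simp add: \<theta>_def)
      have ZT0: "Z p * T \<ge> 0" using T0 Zpos[of p] by simp
      have "exp (Z p * T) \<le> exp 1" using ZT \<epsilon> by simp
      also have "\<dots> \<le> 3" by (rule exp_le)
      finally have "Z p * T * exp (Z p * T) \<le> \<epsilon> / 12 * 3"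
        using ZT ZT0 by (intro mult_mono) auto
      moreover have "\<bar>f p m - 1\<bar> \<le> Z p * T * exp (Z p * T)"
        using tail_fun_near_1[OF nn sb, of m "Z p"] Zpos[of p] by (simp add: f_def T_def)
      ultimately show ?thesis by simp
    qed
    have f1: "\<bar>f p (Suc (2 * p)) - 1\<bar> \<le> \<epsilon> / 4" and f2: "\<bar>f p (Suc (Suc (2 * p))) - 1\<bar> \<le> \<epsilon> / 4"
      using near by auto
    from f1 have f1': "1 - \<epsilon> / 4 \<le> f p (Suc (2 * p))" "f p (Suc (2 * p)) \<le> 1 + \<epsilon> / 4"
      unfolding abs_le_iff by linarith+
    from f2 have f2': "1 - \<epsilon> / 4 \<le> f p (Suc (Suc (2 * p)))" unfolding abs_le_iff by linarith
    have "f p (2 * p) = f p (Suc (2 * p)) - 1 / (1 - \<epsilon>)\<^sup>2 * f p (Suc (Suc (2 * p)))"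
      using rec[of "2 * p" "Z p"] unfolding Zb by (simp add: f_def)
    moreover have "(1 + 2 * \<epsilon>) * (1 - \<epsilon> / 4) \<le> 1 / (1 - \<epsilon>)\<^sup>2 * f p (Suc (Suc (2 * p)))"
      using q_ge f2' \<epsilon> by (intro mult_mono) auto
    moreover have "(1 + 2 * \<epsilon>) * (1 - \<epsilon> / 4) \<ge> 1 + 5 / 4 * \<epsilon>"
    proof -
      have "\<epsilon> * \<epsilon> \<le> 1 * \<epsilon>" using \<epsilon> by (intro mult_right_mono) auto
      then show ?thesis by (simp add: algebra_simps)
    qed
    ultimately have "f p (2 * p) \<le> - \<epsilon>" using f1' by linarith
    moreover have "f p (Suc (2 * p)) > 0" "f p (Suc (2 * p)) \<le> 2" using f1' \<epsilon> by linarith+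
    moreover have "\<epsilon> / 2 * f p (Suc (2 * p)) \<le> \<epsilon> / 2 * 2"
      using \<epsilon> calculation by (intro mult_left_mono) auto
    ultimately have "\<epsilon> / 2 * f p (Suc (2 * p)) \<le> - f p (2 * p)" "f p (Suc (2 * p)) > 0" by linarith+
    then show ?thesis unfolding r_def by (subst pos_le_divide_eq) auto
  qed
  \<comment> \<open>One step in \<open>j\<close> moves two indices in \<open>b\<close>, each worth a
    factor of at least 4.\<close>
  have growth: "16 ^ (p - j) \<le> Z p * b (Suc (2 * j))" if "M \<le> j" "j \<le> p" for j p
    using that(2,1)
  proof (induction j rule: inc_induct)
    case base
    have "1 \<le> 1 / (1 - \<epsilon>)\<^sup>2" using q_ge \<epsilon> by linarith
    then show ?case by (simp add: Zb)
  next
    case (step j)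
    have 1: "16 * b (Suc (2 * Suc j)) \<le> b (Suc (2 * j))"
    proof -
      have d: "4 * b (Suc m) \<le> b m" if "m \<ge> M" for m
      proof -
        have "\<theta> * b m \<le> 1 / 4 * b m" using \<theta> nn by (intro mult_right_mono) auto
        then show ?thesis using dec[OF that] by simp
      qed
      show ?thesis using d[of "Suc (2 * j)"] d[of "Suc (Suc (2 * j))"] step.prems by simp
    qed
    have "(16::real) ^ (p - j) = 16 * 16 ^ (p - Suc j)"
      using step.hyps by (metis Suc_diff_Suc power_Suc)
    also have "\<dots> \<le> 16 * (Z p * b (Suc (2 * Suc j)))" using step by simp
    also have "\<dots> = Z p * (16 * b (Suc (2 * Suc j)))" by simp
    also have "\<dots> \<le> Z p * b (Suc (2 * j))" using 1 Zpos[of p] by (intro mult_left_mono) auto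
    finally show ?case .
  qed
  have large: "f p (Suc (2 * j)) \<noteq> 0 \<and> 2 ^ (p - j) * (\<epsilon> / 2) \<le> r p j" if "M \<le> j" "j \<le> p" for j p
    using that(2,1)
  proof (induction j rule: inc_induct)
    case base
    then show ?case using base_fact[of p] by simp
  next
    case (step j)
    define k where "k = p - Suc j"
    define R where "R = 2 ^ k * (\<epsilon> / 2)"
    have pj: "p - j = Suc k" using step.hyps by (simp add: k_def)
    have R: "R > 0" "\<epsilon> / 2 \<le> R" using \<epsilon> by (auto simp: R_def)
    define A where "A = b (Suc (2 * j))"
    define B where "B = b (2 * Suc j)"
    define z where "z = Z p"
    have z: "z > 0" using Zpos by (simp add: z_def)
    have B: "B > 0" using pos by (simp add: B_def)
    have IH: "f p (Suc (2 * Suc j)) \<noteq> 0" "R \<le> r p (Suc j)"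
      using step.IH step.prems by (auto simp: k_def R_def)
    have "B \<le> \<theta> * A" using dec[of "Suc (2 * j)"] step.prems by (simp add: A_def B_def)
    then have BA: "96 * B \<le> \<epsilon> * A" by (simp add: \<theta>_def)
    have zA: "4 * R + 2 \<le> z * A"
    proof -
      have "R \<le> 2 ^ k * 1" unfolding R_def using \<epsilon> by (intro mult_left_mono) auto
      moreover have "(2::real) ^ k \<le> 16 ^ k" by (rule power_mono) auto
      moreover have "(1::real) \<le> 16 ^ k" by simp
      moreover have "16 * 16 ^ k \<le> z * A"
        using growth[of j p] step.hyps step.prems pj by (simp add: z_def A_def)
      ultimately show ?thesis by linarith
    qed
    \<comment> \<open>This is \<open>2 * R \<le> z * A * R / (R + z * B) - 1\<close>, cleared of the
      denominator. The summands with \<open>R\<close> and with \<open>z * B\<close> each take at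
      most half of the right side.\<close>
    have "(2 * R + 1) * (R + z * B) \<le> z * A * R"
    proof -
      have "2 * ((2 * R + 1) * R) = (4 * R + 2) * R" by (simp add: algebra_simps)
      also have "\<dots> \<le> z * A * R" using zA R by (intro mult_right_mono) auto
      finally have 1: "2 * ((2 * R + 1) * R) \<le> z * A * R" .
      \<comment> \<open>The summand \<open>\<epsilon>\<close> is absorbed through
        \<open>\<epsilon> / 2 \<le> R\<close>.\<close>
      have "\<epsilon> * (2 * R + 1) \<le> 4 * R"
      proof -
        have "\<epsilon> * R \<le> 1 * R" using R \<epsilon> by (intro mult_right_mono) auto
        moreover have "\<epsilon> * (2 * R + 1) = 2 * (\<epsilon> * R) + \<epsilon>" by (simp add: algebra_simps)
        ultimately show ?thesis using R by linarith
      qed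
      then have "\<epsilon> * (2 * R + 1) * (2 * B) \<le> 4 * R * (2 * B)"
        using B by (intro mult_right_mono) auto
      also have "\<dots> \<le> R * (96 * B)" using R B by simp
      also have "\<dots> \<le> R * (\<epsilon> * A)" using BA R by (intro mult_left_mono) auto
      finally have "\<epsilon> * (2 * ((2 * R + 1) * B)) \<le> \<epsilon> * (A * R)" by (simp add: mult_ac)
      then have "2 * ((2 * R + 1) * B) \<le> A * R" using \<epsilon> by simp
      then have "z * (2 * ((2 * R + 1) * B)) \<le> z * (A * R)" using z by (intro mult_left_mono) auto
      then show ?thesis using 1 by (simp add: algebra_simps)
    qed
    then have "2 * R \<le> z * A * R / (R + z * B) - 1"
      using R z B by (simp add: pos_le_divide_eq le_diff_eq add_pos_pos)
    then show ?case
      using step.IH step_fact[OF IH R(1)] by (simp add: pj R_def A_def B_def z_def)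
  qed
  have Z_top: "filterlim Z at_top sequentially"
  proof -
    have "(\<lambda>p. b (Suc (2 * p))) \<longlonglongrightarrow> 0"
      using LIMSEQ_subseq_LIMSEQ[OF summable_LIMSEQ_zero[OF sb], of "\<lambda>p. Suc (2 * p)"]
      by (simp add: strict_mono_def o_def)
    then have "(\<lambda>p. (1 - \<epsilon>)\<^sup>2 * b (Suc (2 * p))) \<longlonglongrightarrow> (1 - \<epsilon>)\<^sup>2 * 0"
      by (intro tendsto_intros)
    moreover have "(1 - \<epsilon>)\<^sup>2 * b (Suc (2 * p)) > 0" for p using pos \<epsilon> by simp
    ultimately have "filterlim (\<lambda>p. (1 - \<epsilon>)\<^sup>2 * b (Suc (2 * p))) (at_right 0) sequentially"
      by (intro tendsto_imp_filterlim_at_right always_eventually allI) simp_all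
    then have "filterlim (\<lambda>p. inverse ((1 - \<epsilon>)\<^sup>2 * b (Suc (2 * p)))) at_top sequentially"
      by (rule filterlim_compose[OF filterlim_inverse_at_top_right])
    then show ?thesis by (simp add: Z_def inverse_eq_divide)
  qed
  text \<open>Below \<open>M\<close> the sequence \<open>b\<close> need not decrease; there only \<open>Z p \<longrightarrow> \<infinity>\<close> for fixed \<open>j\<close> is used.\<close>
  have small: "\<forall>X. eventually (\<lambda>p. f p (Suc (2 * j)) \<noteq> 0 \<and> X \<le> r p j) sequentially"
    if "j \<le> M" for j
    using that
  proof (induction j rule: inc_induct)
    case base
    show ?case
    proof
      fix X :: real
      have "filterlim (\<lambda>p. 2 ^ p * (\<epsilon> / 2)) at_top sequentially"
        using \<epsilon> by (intro filterlim_at_top_mult_tendsto_pos[OF tendsto_const])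
          (auto intro!: filterlim_at_infinity_imp_filterlim_at_top
            filterlim_realpow_sequentially_gt1 always_eventually)
      then have "eventually (\<lambda>p. X * 2 ^ M \<le> 2 ^ p * (\<epsilon> / 2)) sequentially"
        by (simp add: filterlim_at_top)
      then show "eventually (\<lambda>p. f p (Suc (2 * M)) \<noteq> 0 \<and> X \<le> r p M) sequentially"
        using eventually_ge_at_top[of M]
      proof eventually_elim
        case (elim p)
        then have "X \<le> 2 ^ (p - M) * (\<epsilon> / 2)"
          by (simp add: power_diff field_simps)
        then show ?case using large[of M p] elim by linarith
      qed
    qed
  next
    case (step j)
    show ?case
    proof
      fix X :: real
      define A where "A = b (Suc (2 * j))"
      define B where "B = b (2 * Suc j)"
      have AB: "A > 0" "B > 0" using pos by (auto simp: A_def B_def)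
      \<comment> \<open>Chosen so that \<open>A * R / (2 * B) = \<bar>X\<bar> + 1\<close>, which
        bounds the quotient from below once \<open>R \<le> Z p * B\<close>. The next ratio must
        exceed this \<open>R\<close>, hence the induction over all \<open>X\<close>.\<close>
      define R where "R = 2 * B * (\<bar>X\<bar> + 1) / A"
      have R: "R > 0" using AB by (simp add: R_def)
      have "eventually (\<lambda>p. R / B \<le> Z p) sequentially"
        using Z_top by (simp add: filterlim_at_top)
      then show "eventually (\<lambda>p. f p (Suc (2 * j)) \<noteq> 0 \<and> X \<le> r p j) sequentially"
        using spec[OF step.IH, of R]
      proof eventually_elim
        case (elim p)
        have ZB: "R \<le> Z p * B" "Z p * B > 0" using elim(1) AB Zpos[of p] by (simp_all add: field_simps)
        have "Z p * A * R / (2 * (Z p * B)) \<le> Z p * A * R / (R + Z p * B)"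
          using R AB Zpos[of p] ZB by (intro divide_left_mono mult_pos_pos add_pos_pos)
            (simp_all add: mult.commute)
        moreover have "Z p * A * R / (2 * (Z p * B)) = \<bar>X\<bar> + 1"
          using AB Zpos[of p] by (simp add: R_def)
        ultimately have "X \<le> Z p * A * R / (R + Z p * B) - 1" by linarith
        then show ?case
          using step_fact[of p j R] elim(2) R unfolding A_def B_def by linarith
      qed
    qed
  qed
  have "eventually (\<lambda>p. \<forall>j\<in>{..<M}. f p (Suc (2 * j)) \<noteq> 0 \<and> 1 \<le> r p j) sequentially"
    by (intro eventually_ball_finite ballI) (use small in auto)
  then show ?thesis
    using eventually_ge_at_top[of M]
  proof eventually_elim
    case (elim p)
    show ?case
    proof (intro allI impI)
      fix j assume j: "j \<le> p"
      have "f p (Suc (2 * j)) \<noteq> 0 \<and> 0 < r p j"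
      proof (cases "j < M")
        case True
        then show ?thesis using elim by force
      next
        case False
        moreover have "2 ^ (p - j) * (\<epsilon> / 2) > 0" using \<epsilon> by simp
        ultimately show ?thesis using large[of j p] j by linarith
      qed
      then have "f p (2 * j) * f p (Suc (2 * j)) < 0"
        by (auto simp: r_def divide_less_0_iff mult_less_0_iff)
      then show "tail_fun b (2 * j) (Z p) * tail_fun b (Suc (2 * j)) (Z p) < 0"
        by (simp add: f_def)
    qed
  qed
qed

section \<open>Counting eigenvalues above a threshold\<close>

text \<open>Pigeonhole: if \<open>lam n < c\<close>, all of \<open>E\<close> would lie among the
  \<open>n - 1\<close> values preceding \<open>lam n\<close>.\<close>

lemma finite_subset_enumeration_bound:
  fixes lam :: "nat \<Rightarrow> real"
  assumes dec: "\<And>m n. 1 \<le> m \<Longrightarrow> m < n \<Longrightarrow> lam n < lam m"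
    and E: "E \<subseteq> lam ` {1..}" "card E = n" "n \<ge> 1" and ge: "\<And>e. e \<in> E \<Longrightarrow> c \<le> e"
  shows "c \<le> lam n"
proof (rule ccontr)
  assume "\<not> c \<le> lam n"
  then have lt: "lam n < c" by simp
  have "E \<subseteq> lam ` {1..<n}"
  proof
    fix e assume e: "e \<in> E"
    then obtain k where k: "k \<ge> 1" "e = lam k" using E(1) by auto
    have "k < n"
    proof (rule ccontr)
      assume "\<not> k < n"
      then have "lam k \<le> lam n" using dec[OF E(3), of k] by (cases "k = n") auto
      then show False using ge[OF e] k(2) lt by simp
    qed
    then show "e \<in> lam ` {1..<n}" using k by auto
  qed
  then have "card E \<le> card (lam ` {1..<n})" by (intro card_mono) auto
  also have "\<dots> \<le> n - 1" using card_image_le[of "{1..<n}" lam] by simp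
  finally show False using E by simp
qed

lemma sign_changes_ge:
  assumes "\<And>j. j < n \<Longrightarrow> s (2 * j) * s (Suc (2 * j)) < 0" and "2 * n \<le> N"
  shows "n \<le> sign_changes N s 0"
proof -
  have "n = (\<Sum>m\<in>(\<lambda>j. 2 * j) ` {..<n}. 1)" by (simp add: card_image inj_on_def)
  also have "\<dots> \<le> (\<Sum>m\<in>(\<lambda>j. 2 * j) ` {..<n}. of_bool ((s m > 0) \<noteq> (s (Suc m) > 0)))"
  proof (rule sum_mono)
    fix m assume "m \<in> (\<lambda>j. 2 * j) ` {..<n}"
    then have "s m * s (Suc m) < 0" using assms(1) by auto
    then show "(1::nat) \<le> of_bool ((s m > 0) \<noteq> (s (Suc m) > 0))" by (auto simp: mult_less_0_iff)
  qed
  also have "\<dots> \<le> sign_changes N s 0"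
    unfolding sign_changes_def using assms(2) by (intro sum_mono2) auto
  finally show ?thesis .
qed

text \<open>The Sturm count is 0 at \<open>z = 0\<close> and at least \<open>n\<close> at
  \<open>z = 1 / c\<^sup>2\<close>; a zero of \<open>f 0\<close> in between gives the eigenvalue
  \<open>1 / sqrt z \<ge> c\<close>.\<close>

lemma many_eigenvalues:
  fixes a :: "nat \<Rightarrow> real"
  assumes pos: "\<And>n. n \<ge> 1 \<Longrightarrow> a n > 0" and a: "a \<longlonglongrightarrow> 0" and sa: "summable (\<lambda>j. (a j)\<^sup>2)"
    and c: "c > 0"
    and alt: "\<And>j. j < n \<Longrightarrow> tail_fun (\<lambda>j. (a j)\<^sup>2) (2 * j) (1 / c\<^sup>2) *
      tail_fun (\<lambda>j. (a j)\<^sup>2) (Suc (2 * j)) (1 / c\<^sup>2) < 0" and n: "n \<ge> 1"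
  shows "\<exists>E\<subseteq>positive_eigenvalues (jacobi_op a). card E = n \<and> (\<forall>e\<in>E. c \<le> e)"
proof -
  define b where "b = (\<lambda>j. (a j)\<^sup>2)"
  define f where "f = tail_fun b"
  define q where "q = 1 / c\<^sup>2"
  have q: "q > 0" using c by (simp add: q_def)
  have nn: "b j \<ge> 0" for j by (simp add: b_def)
  have sb: "summable b" using sa by (simp add: b_def)
  have rec: "f m z = f (Suc m) z - z * b (Suc m) * f (Suc (Suc m)) z" for m z
    unfolding f_def by (rule tail_fun_rec[OF nn sb])
  have f0: "f m 0 = 1" for m unfolding f_def by (rule tail_fun_0[OF nn sb])
  define T where "T = (\<lambda>m. \<Sum>i. b (Suc m + i))"
  have T: "T m \<ge> 0" for m unfolding T_def by (intro suminf_nonneg summable_shift_left sb nn)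
  have "T \<longlonglongrightarrow> 0" unfolding T_def by (rule tail_sum_tendsto_0[OF sb])
  then have "(\<lambda>m. q * T m * exp (q * T m)) \<longlonglongrightarrow> q * 0 * exp (q * 0)"
    by (intro tendsto_intros)
  then have "eventually (\<lambda>m. q * T m * exp (q * T m) < 1) sequentially"
    by (rule order_tendstoD) simp
  then obtain N0 where N0: "\<And>m. m \<ge> N0 \<Longrightarrow> q * T m * exp (q * T m) < 1"
    by (auto simp: eventually_sequentially)
  \<comment> \<open>The bound on the distance to 1 increases with \<open>z\<close>, so control at
    the right end \<open>q\<close> covers the whole interval.\<close>
  have f_pos: "f m z > 0" if "m \<ge> N0" "0 \<le> z" "z \<le> q" for m z
  proof -
    have "z * T m * exp (z * T m) \<le> q * T m * exp (q * T m)"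
      using that T[of m] by (intro mult_mono) (auto intro: mult_right_mono)
    then have "\<bar>f m z - 1\<bar> < 1"
      using tail_fun_near_1[OF nn sb, of m z] N0[OF that(1)] that(2) by (simp add: f_def T_def)
    then show ?thesis by linarith
  qed
  \<comment> \<open>Large enough for \<open>f N\<close> to be positive on the interval and for the
    \<open>n\<close> alternating pairs to fit.\<close>
  define N where "N = max N0 (2 * n)"
  \<comment> \<open>By the recurrence two consecutive zeros propagate to all later members, against
    positivity from \<open>N0\<close> on.\<close>
  have no_double_zero: "False" if "f m z = 0" "f (Suc m) z = 0" "0 < z" "z \<le> q" for m z
  proof -
    have "f (m + k) z = 0 \<and> f (Suc (m + k)) z = 0" for k
    proof (induction k)
      case (Suc k)
      have "b (Suc (m + k)) > 0" using pos[of "Suc (m + k)"] by (simp add: b_def)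
      moreover have "z * b (Suc (m + k)) * f (Suc (Suc (m + k))) z = 0"
        using Suc.IH rec[of "m + k" z] by linarith
      ultimately show ?case using Suc.IH that(3) by auto
    qed (use that in simp)
    then have "f (m + N0) z = 0" by blast
    then show False using f_pos[of "m + N0" z] that by simp
  qed
  have "\<exists>S\<subseteq>{0..q}. finite S \<and> card S = n \<and> (\<forall>z\<in>S. f 0 z = 0)"
  proof (rule sturm_chain_zeros[where N = N])
    show "isCont (f m) z" for m z unfolding f_def by (rule isCont_tail_fun[OF nn sb])
    show "f m z * f (Suc (Suc m)) z < 0" if z: "0 \<le> z" "z \<le> q" "f (Suc m) z = 0" for m z
    proof -
      have z0: "z > 0" using z f0[of "Suc m"] by (cases "z = 0") auto
      have "b (Suc m) > 0" using pos[of "Suc m"] by (simp add: b_def)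
      then have k: "z * b (Suc m) > 0" using z0 by simp
      have "f (Suc (Suc m)) z \<noteq> 0" using no_double_zero[of "Suc m" z] z z0 by blast
      then have "z * b (Suc m) * (f (Suc (Suc m)) z)\<^sup>2 > 0" using k by simp
      moreover have "f m z * f (Suc (Suc m)) z = - (z * b (Suc m) * (f (Suc (Suc m)) z)\<^sup>2)"
        using rec[of m z] z(3) by (simp add: power2_eq_square)
      ultimately show ?thesis by linarith
    qed
    show "f N z \<noteq> 0" if "0 \<le> z" "z \<le> q" for z
      using f_pos[of N z] that by (simp add: N_def)
    show "sign_changes N (\<lambda>m. f m 0) 0 = 0" by (simp add: sign_changes_def f0)
    show "n \<le> sign_changes N (\<lambda>m. f m q) 0"
      using alt by (intro sign_changes_ge) (auto simp: N_def f_def b_def q_def)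
    show "f 0 q \<noteq> 0" using alt[of 0] n by (auto simp: f_def b_def q_def)
  qed (use q n in \<open>auto simp: N_def\<close>)
  then obtain S where S: "S \<subseteq> {0..q}" "card S = n" "\<And>z. z \<in> S \<Longrightarrow> f 0 z = 0" by blast
  have S_pos: "z > 0" if "z \<in> S" for z
    using that S(1,3) f0[of 0] by (cases "z = 0") force+
  have inj: "inj_on (\<lambda>z. 1 / sqrt z) S" using S_pos by (auto simp: inj_on_def)
  have "1 / sqrt z \<in> positive_eigenvalues (jacobi_op a)" if "z \<in> S" for z
    using S(3)[OF that] S_pos[OF that] unfolding f_def b_def
    by (intro eigenvalue_of_tail_fun_zero pos a sa)
  moreover have "c \<le> 1 / sqrt z" if "z \<in> S" for z
  proof -
    have "sqrt z \<le> sqrt q" using S(1) that by auto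
    also have "\<dots> = 1 / c" using c by (simp add: q_def real_sqrt_divide)
    finally show ?thesis using c S_pos[OF that] by (simp add: field_simps)
  qed
  ultimately show ?thesis
    using S(2) inj by (intro exI[of _ "(\<lambda>z. 1 / sqrt z) ` S"]) (auto simp: card_image)
qed

section \<open>Squeezing the quotient between the two bounds\<close>

theorem theorem1p1:
  fixes a :: "nat \<Rightarrow> real" and lam :: "nat \<Rightarrow> real"
  assumes pos: "\<And>n. n \<ge> 1 \<Longrightarrow> a n > 0"
    and ratio: "(\<lambda>n. a (n + 1) / a n) \<longlonglongrightarrow> 0"
    and lam_enum: "lam ` {1..} = positive_eigenvalues (jacobi_op a)"
    and lam_decreasing: "\<And>m n. 1 \<le> m \<Longrightarrow> m < n \<Longrightarrow> lam n < lam m"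
  shows "(\<lambda>n. lam n / a (2 * n - 1)) \<longlonglongrightarrow> 1"
proof -
  have ratio': "(\<lambda>n. a (Suc n) / a n) \<longlonglongrightarrow> 0" using ratio by simp
  have a0: "a \<longlonglongrightarrow> 0" by (rule summable_LIMSEQ_zero[OF summable_if_ratio_tendsto_0[OF pos ratio']])
  have ratio2: "(\<lambda>n. (a (Suc n))\<^sup>2 / (a n)\<^sup>2) \<longlonglongrightarrow> 0"
    using tendsto_power[OF ratio', of 2] by (simp add: power_divide)
  have pos2: "(a n)\<^sup>2 > 0" if "n \<ge> 1" for n using pos[OF that] by simp
  have sa: "summable (\<lambda>j. (a j)\<^sup>2)" by (rule summable_if_ratio_tendsto_0[OF pos2 ratio2])
  have idx: "filterlim (\<lambda>n. 2 * n - 1 :: nat) at_top sequentially"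
    unfolding filterlim_at_top
  proof
    fix M :: nat
    show "eventually (\<lambda>n. M \<le> 2 * n - 1) sequentially"
      using eventually_ge_at_top[of "M + 1"] by eventually_elim simp
  qed
  have upper: "eventually (\<lambda>n. lam n / a (2 * n - 1) \<le> 1 + a (2 * n) / a (2 * n - 1)) sequentially"
  proof -
    have "eventually (\<lambda>n. a (Suc n) / a n < 1) sequentially"
      using order_tendstoD(2)[OF ratio'] by simp
    then obtain M where M: "\<And>m. m \<ge> M \<Longrightarrow> a (Suc m) / a m < 1"
      by (auto simp: eventually_sequentially)
    show ?thesis
      using eventually_ge_at_top[of "M + 1"]
    proof eventually_elim
      case (elim n)
      have "lam n \<le> a (2 * n - 1) + a (2 * n)"
      proof (rule eigenvalue_upper_bound[OF _ a0])
        \<comment> \<open>\<open>a\<close> decreases from \<open>max M 1\<close> on, and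
          \<open>n > M\<close> puts \<open>2 * n - 1\<close> in that range.\<close>
        show "a (Suc m) \<le> a m" if "m \<ge> 2 * n - 1" for m
        proof -
          have "m \<ge> M" "m \<ge> 1" using that elim by linarith+
          then show ?thesis using M[of m] pos[of m] by (simp add: field_simps)
        qed
        show "lam i \<in> positive_eigenvalues (jacobi_op a)" if "1 \<le> i" "i \<le> n" for i
          unfolding lam_enum[symmetric] using that by auto
      qed (use elim pos lam_decreasing in auto)
      moreover have an: "a (2 * n - 1) > 0" using elim by (intro pos) simp
      ultimately have "lam n / a (2 * n - 1) \<le> (a (2 * n - 1) + a (2 * n)) / a (2 * n - 1)"
        by (intro divide_right_mono) auto
      then show ?case using an by (simp add: add_divide_distrib)
    qed
  qed
  have lower: "eventually (\<lambda>n. 1 - \<epsilon> \<le> lam n / a (2 * n - 1)) sequentially"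
    if \<epsilon>: "0 < \<epsilon>" "\<epsilon> \<le> 1 / 2" for \<epsilon>
  proof -
    have "eventually (\<lambda>p. \<forall>j\<le>p.
        tail_fun (\<lambda>j. (a j)\<^sup>2) (2 * j) (1 / ((1 - \<epsilon>)\<^sup>2 * (a (Suc (2 * p)))\<^sup>2)) *
        tail_fun (\<lambda>j. (a j)\<^sup>2) (Suc (2 * j)) (1 / ((1 - \<epsilon>)\<^sup>2 * (a (Suc (2 * p)))\<^sup>2)) < 0) sequentially"
      by (rule tail_fun_alternates[OF pos2 _ ratio2 \<epsilon>]) auto
    \<comment> \<open>The pairs \<open>j \<le> p\<close> number \<open>Suc p\<close>, so
      \<open>n = Suc p\<close>, and \<open>2 * n - 1\<close> is \<open>Suc (2 * p)\<close>.\<close>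
    then have "eventually (\<lambda>p. 1 - \<epsilon> \<le> lam (Suc p) / a (2 * Suc p - 1)) sequentially"
    proof eventually_elim
      case (elim p)
      define c where "c = (1 - \<epsilon>) * a (Suc (2 * p))"
      have ap: "a (Suc (2 * p)) > 0" using pos by simp
      then have c: "c > 0" using \<epsilon> by (simp add: c_def)
      obtain E where E: "E \<subseteq> positive_eigenvalues (jacobi_op a)" "card E = Suc p" "\<forall>e\<in>E. c \<le> e"
        using many_eigenvalues[OF pos a0 sa c, of "Suc p"] elim
        by (auto simp: c_def power_mult_distrib less_Suc_eq_le)
      have "c \<le> lam (Suc p)"
        using E by (intro finite_subset_enumeration_bound[OF lam_decreasing, where E = E])
          (auto simp: lam_enum[symmetric])
      then show ?case using ap by (simp add: c_def pos_le_divide_eq)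
    qed
    then show ?thesis
      using eventually_sequentially_Suc[of "\<lambda>n. 1 - \<epsilon> \<le> lam n / a (2 * n - 1)"] by blast
  qed
  show ?thesis
  proof (rule order_tendstoI)
    fix l :: real assume l: "l < 1"
    define \<epsilon> where "\<epsilon> = min (1 / 2) ((1 - l) / 2)"
    have "0 < \<epsilon>" "\<epsilon> \<le> 1 / 2" "l < 1 - \<epsilon>" using l by (auto simp: \<epsilon>_def min_def field_simps)
    then show "eventually (\<lambda>n. l < lam n / a (2 * n - 1)) sequentially"
      using lower[of \<epsilon>] by (auto elim: eventually_mono)
  next
    fix u :: real assume u: "1 < u"
    \<comment> \<open>\<open>Suc (2 * n - 1)\<close> is \<open>2 * n\<close> once
      \<open>n \<ge> 1\<close>, so this is the error term of the upper bound.\<close>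
    have "(\<lambda>n. a (Suc (2 * n - 1)) / a (2 * n - 1)) \<longlonglongrightarrow> 0"
      by (rule filterlim_compose[OF ratio' idx])
    then have "eventually (\<lambda>n. a (Suc (2 * n - 1)) / a (2 * n - 1) < u - 1) sequentially"
      by (rule order_tendstoD) (use u in simp)
    with upper show "eventually (\<lambda>n. lam n / a (2 * n - 1) < u) sequentially"
      using eventually_ge_at_top[of 1]
    proof eventually_elim
      case (elim n)
      then show ?case by simp
    qed
  qed
qed

end
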